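(* Let $\mathcal K_{r,\rho}$ be the trajectory of a symmetrical configuration $\gamma_{r,\rho}$ of the first kind, with spectral parameter $r=\frac mn\in(-2,-1/2)$, $m,n\in\mathbb Z$, $\gcd(m,n)=1$, $m<0$ (so $n>0$), and Clifford parameter $\rho$, $(r,\rho)\in\mathfrak A$. Then: (1) $\mathcal K_{r,\rho}$ has spin $1/3$ and phase anomaly $4\pi/3$ if and only if there exist $h,k\in\mathbb Z$, $h<0$, $k>0$, such that $m=1+3h$ and $n=1+3k$; (2) $\mathcal K_{r,\rho}$ has spin $1/3$ and phase anomaly $2\pi/3$ if and only if there exist $h,k\in\mathbb Z$, $h<0$, $k>0$, such that $m=2+3h$ and $n=2+3k$.
   Context: $\mathbb C^{2,1}$ is $\mathbb C^3$ with the Hermitian form $\langle \mathbf z,\mathbf w\rangle={}^t\overline{\mathbf z}\,\mathbf h\,\mathbf w$, $\mathbf h=\begin{pmatrix}0&0&i\\0&1&0\\-i&0&0\end{pmatrix}$. $\mathcal N$ is the set of nonzero null vectors, $\mathcal S=\{[\mathbf z]\in\mathbb{CP}^2:\langle\mathbf z,\mathbf z\rangle=0\}$. A lift of a smooth curve $\gamma:\mathbb R\to\mathcal S$ is a smooth $\Gamma:\mathbb R\to\mathcal N$ with $\gamma=[\Gamma]$. $\gamma$ is (positively parametrized) transversal if $-i\langle\Gamma,\Gamma'\rangle>0$, and generic if $\det(\Gamma,\Gamma',\Gamma'')$ never vanishes. A Wilczynski lift has $\det(\Gamma,\Gamma',\Gamma'')=-1$ (unique up to cube roots of unity); the parametrization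 is natural if moreover $i\langle\Gamma,\Gamma'\rangle^{-1}=1$. Phase anomaly and spin. A generic transversal knot $\mathcal K$ is the image of a periodic generic transversal curve that is injective on $[0,\omega)$, $\omega$ the minimal period. Let $\gamma:\mathbb R\to\mathcal S$ be a natural parametrization of $\mathcal K$ with minimal period $\omega$ and $\Gamma$ a Wilczynski lift. Then $\Gamma(\omega)=\varepsilon_\gamma\Gamma(0)$ with $\varepsilon_\gamma$ a cube root of unity independent of $\Gamma$. The phase anomaly of $\mathcal K$ is the argument of $\varepsilon_\gamma$ in $[0,2\pi)$. The (CR) spin of $\mathcal K$ is $1/3$ if $\varepsilon_\gamma\neq1$ and $1$ if $\varepsilon_\gamma=1$. Symmetrical configurations of the first kind. Let $$\mathfrak A=\Big\{(r,\rho)\in(-2,-\tfrac12)\times(0,\sqrt2):\rho<\sqrt{\tfrac{2(-3+2\sqrt{2-r-r^2})}{1+2r}}\Big\},$$ $$\mu_1(r,\rho)=\frac{4+8r+12\rho^2+(1+2r)\rho^4}{4+8r+12\rho^2+(1+2r)\rho^4-2\big((2+3r-3r^2-2r^3)(-4\rho+\rho^5)\big)^{2/3}}\in(0,1),$$ $e_1^1=r\frac{\mu_1}{1-\mu_1}$, $e_1^2=-(1+r)\frac{\mu_1}{1-\mu_1}$, $e_1^3=\frac{\mu_1}{1-\mu_1}$, $D_1(r,\rho)=\mathrm{diag}(-ie_1^2,-ie_1^3,-ie_1^1)$, $\mathcal U=\begin{pmatrix}\frac1{\sqrt2}&0&\frac i{\sqrt2}\\0&1&0\\\frac i{\sqrt2}&0&\frac1{\sqrt2}\end{pmatrix}$,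 $S(\rho)=[{}^t(1,\rho,i\rho^2/2)]\in\mathcal S$. For $(r,\rho)\in\mathfrak A$, $r\in\mathbb Q$, the symmetrical configuration of the first kind with spectral parameter $r$ and Clifford parameter $\rho$ is $\gamma_{r,\rho}(s)=\big(\mathcal U\exp(sD_1(r,\rho))\,\mathcal U^{-1}\big)S(\rho)$; it is a natural parametrization of a generic transversal knot $\mathcal K_{r,\rho}$ (its trajectory). *)

theory Defs
  imports "HOL-Analysis.Analysis"
begin

section \<open>The Hermitian space, the projective plane and the hyperquadric\<close>

definition hmat :: "complex^3^3" where
  "hmat = vector [vector [0, 0, \<i>], vector [0, 1, 0], vector [-\<i>, 0, 0]]"

definition herm :: "complex^3 \<Rightarrow> complex^3 \<Rightarrow> complex" where
  "herm z w = (\<Sum>i\<in>UNIV. cnj (z $ i) * (hmat *v w) $ i)"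

definition null_vectors :: "(complex^3) set" where
  "null_vectors = {z. z \<noteq> 0 \<and> herm z z = 0}"

text \<open>A point \<open>[z]\<close> of the complex projective plane is the complex line through \<open>z \<noteq> 0\<close>;
  \<open>vec.span\<close> is the span over the field of entries, here the complex numbers.\<close>

type_synonym cpoint = "(complex^3) set"

definition cproj :: "complex^3 \<Rightarrow> cpoint" where
  "cproj z = vec.span {z}"

definition hyperquadric :: "cpoint set" where
  "hyperquadric = {cproj z | z. z \<noteq> 0 \<and> herm z z = 0}"

definition proj_act :: "complex^3^3 \<Rightarrow> cpoint \<Rightarrow> cpoint" where
  "proj_act A p = (*v) A ` p"

section \<open>Curves and lifts\<close>

text \<open>Infinite differentiability; used for open \<open>I\<close> only. \<open>D k\<close> is the \<open>k\<close>-th derivative.\<close>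

definition smooth_on :: "real set \<Rightarrow> (real \<Rightarrow> complex^3) \<Rightarrow> bool" where
  "smooth_on I f \<longleftrightarrow> (\<exists>D. (\<forall>t\<in>I. D 0 t = f t) \<and>
     (\<forall>k. \<forall>t\<in>I. (D k has_vector_derivative D (Suc k) t) (at t)))"

text \<open>The smooth structure of the projective plane is the one for which the projection
  \<open>z \<mapsto> [z]\<close> is a submersion: a map into it is smooth iff it has smooth local lifts.\<close>

definition smooth_curve :: "(real \<Rightarrow> cpoint) \<Rightarrow> bool" where
  "smooth_curve \<gamma> \<longleftrightarrow> (\<forall>t. \<gamma> t \<in> hyperquadric) \<and>
     (\<forall>t. \<exists>I Z. open I \<and> t \<in> I \<and> smooth_on I Z \<and> (\<forall>u\<in>I. Z u \<noteq> 0 \<and> \<gamma> u = cproj (Z u)))"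

definition is_lift :: "(real \<Rightarrow> complex^3) \<Rightarrow> (real \<Rightarrow> cpoint) \<Rightarrow> bool" where
  "is_lift \<Gamma> \<gamma> \<longleftrightarrow> smooth_on UNIV \<Gamma> \<and> (\<forall>t. \<Gamma> t \<in> null_vectors \<and> \<gamma> t = cproj (\<Gamma> t))"

definition vderiv :: "(real \<Rightarrow> complex^3) \<Rightarrow> real \<Rightarrow> complex^3" where
  "vderiv \<Gamma> = (\<lambda>t. vector_derivative \<Gamma> (at t))"

definition lift_det :: "(real \<Rightarrow> complex^3) \<Rightarrow> real \<Rightarrow> complex" where
  "lift_det \<Gamma> t = det (vector [\<Gamma> t, vderiv \<Gamma> t, vderiv (vderiv \<Gamma>) t] :: complex^3^3)"

text \<open>Replacing a lift \<open>\<Gamma>\<close> by \<open>f\<Gamma>\<close> multiplies \<open>herm \<Gamma> \<Gamma>'\<close> by \<open>|f|\<^sup>2\<close> and the determinant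
  by \<open>f\<^sup>3\<close>, so the next two conditions do not depend on the lift. On null lifts
  \<open>herm \<Gamma> \<Gamma>'\<close> is purely imaginary.\<close>

definition transversal :: "(real \<Rightarrow> cpoint) \<Rightarrow> bool" where
  "transversal \<gamma> \<longleftrightarrow> (\<exists>\<Gamma>. is_lift \<Gamma> \<gamma> \<and>
     (\<forall>t. - \<i> * herm (\<Gamma> t) (vderiv \<Gamma> t) \<in> \<real> \<and> Re (- \<i> * herm (\<Gamma> t) (vderiv \<Gamma> t)) > 0))"

definition generic :: "(real \<Rightarrow> cpoint) \<Rightarrow> bool" where
  "generic \<gamma> \<longleftrightarrow> (\<exists>\<Gamma>. is_lift \<Gamma> \<gamma> \<and> (\<forall>t. lift_det \<Gamma> t \<noteq> 0))"

definition wilczynski_lift :: "(real \<Rightarrow> complex^3) \<Rightarrow> (real \<Rightarrow> cpoint) \<Rightarrow> bool" where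
  "wilczynski_lift \<Gamma> \<gamma> \<longleftrightarrow> is_lift \<Gamma> \<gamma> \<and> (\<forall>t. lift_det \<Gamma> t = -1)"

definition natural :: "(real \<Rightarrow> cpoint) \<Rightarrow> bool" where
  "natural \<gamma> \<longleftrightarrow> (\<exists>\<Gamma>. wilczynski_lift \<Gamma> \<gamma> \<and>
     (\<forall>t. \<i> * inverse (herm (\<Gamma> t) (vderiv \<Gamma> t)) = 1))"

section \<open>Knots, phase anomaly and spin\<close>

definition minimal_period :: "(real \<Rightarrow> 'a) \<Rightarrow> real \<Rightarrow> bool" where
  "minimal_period \<gamma> \<omega> \<longleftrightarrow> \<omega> > 0 \<and> (\<forall>t. \<gamma> (t + \<omega>) = \<gamma> t) \<and>
     (\<forall>p>0. (\<forall>t. \<gamma> (t + p) = \<gamma> t) \<longrightarrow> \<omega> \<le> p)"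

definition knot_parametrization :: "(real \<Rightarrow> cpoint) \<Rightarrow> cpoint set \<Rightarrow> bool" where
  "knot_parametrization \<gamma> K \<longleftrightarrow> smooth_curve \<gamma> \<and> transversal \<gamma> \<and> generic \<gamma> \<and>
     (\<exists>\<omega>. minimal_period \<gamma> \<omega> \<and> inj_on \<gamma> {0..<\<omega>}) \<and> range \<gamma> = K"

definition natural_parametrization :: "(real \<Rightarrow> cpoint) \<Rightarrow> cpoint set \<Rightarrow> bool" where
  "natural_parametrization \<gamma> K \<longleftrightarrow> knot_parametrization \<gamma> K \<and> natural \<gamma>"

definition curve_eps :: "(real \<Rightarrow> cpoint) \<Rightarrow> complex" where
  "curve_eps \<gamma> = (THE \<epsilon>. \<exists>\<Gamma> \<omega>. wilczynski_lift \<Gamma> \<gamma> \<and> minimal_period \<gamma> \<omega> \<and> \<Gamma> \<omega> = \<epsilon> *s \<Gamma> 0)"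

text \<open>Natural parametrizations of the same knot differ by a translation of the parameter, and
  \<open>curve_eps\<close> is invariant under translations; hence \<open>knot_eps\<close> is well defined on generic
  transversal knots.\<close>

definition knot_eps :: "cpoint set \<Rightarrow> complex" where
  "knot_eps K = (THE \<epsilon>. \<exists>\<gamma>. natural_parametrization \<gamma> K \<and> \<epsilon> = curve_eps \<gamma>)"

definition phase_anomaly :: "cpoint set \<Rightarrow> real" where
  "phase_anomaly K = Arg2pi (knot_eps K)"

definition cr_spin :: "cpoint set \<Rightarrow> real" where
  "cr_spin K = (if knot_eps K = 1 then 1 else 1 / 3)"

section \<open>Symmetrical configurations of the first kind\<close>

definition config_domain :: "(real \<times> real) set" where
  "config_domain = {(r, \<rho>). - 2 < r \<and> r < - 1 / 2 \<and> 0 < \<rho> \<and> \<rho> < sqrt 2 \<and>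
     \<rho> < sqrt (2 * (- 3 + 2 * sqrt (2 - r - r^2)) / (1 + 2 * r))}"

text \<open>On \<open>config_domain\<close> the base of the real power is positive, both of its factors being
  negative.\<close>

definition mu1 :: "real \<Rightarrow> real \<Rightarrow> real" where
  "mu1 r \<rho> = (4 + 8 * r + 12 * \<rho>^2 + (1 + 2 * r) * \<rho>^4) /
     (4 + 8 * r + 12 * \<rho>^2 + (1 + 2 * r) * \<rho>^4
       - 2 * ((2 + 3 * r - 3 * r^2 - 2 * r^3) * (- 4 * \<rho> + \<rho>^5)) powr (2 / 3))"

definition e11 :: "real \<Rightarrow> real \<Rightarrow> real" where
  "e11 r \<rho> = r * (mu1 r \<rho> / (1 - mu1 r \<rho>))"

definition e12 :: "real \<Rightarrow> real \<Rightarrow> real" where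
  "e12 r \<rho> = - (1 + r) * (mu1 r \<rho> / (1 - mu1 r \<rho>))"

definition e13 :: "real \<Rightarrow> real \<Rightarrow> real" where
  "e13 r \<rho> = mu1 r \<rho> / (1 - mu1 r \<rho>)"

definition D1 :: "real \<Rightarrow> real \<Rightarrow> complex^3^3" where
  "D1 r \<rho> = vector [vector [- \<i> * of_real (e12 r \<rho>), 0, 0],
                     vector [0, - \<i> * of_real (e13 r \<rho>), 0],
                     vector [0, 0, - \<i> * of_real (e11 r \<rho>)]]"

text \<open>The powers are taken with respect to the matrix product; the operations \<open>*\<close> and \<open>^\<close>
  on the vector type are componentwise.\<close>

definition mat_exp :: "complex^3^3 \<Rightarrow> complex^3^3" where
  "mat_exp A = (\<Sum>k. (1 / fact k) *\<^sub>R (((**) A ^^ k) (mat 1)))"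

definition Umat :: "complex^3^3" where
  "Umat = vector [vector [of_real (1 / sqrt 2), 0, \<i> * of_real (1 / sqrt 2)],
                  vector [0, 1, 0],
                  vector [\<i> * of_real (1 / sqrt 2), 0, of_real (1 / sqrt 2)]]"

definition Spt :: "real \<Rightarrow> cpoint" where
  "Spt \<rho> = cproj (vector [1, of_real \<rho>, \<i> * of_real (\<rho>^2 / 2)])"

definition sym_config :: "real \<Rightarrow> real \<Rightarrow> real \<Rightarrow> cpoint" where
  "sym_config r \<rho> = (\<lambda>s. proj_act (Umat ** mat_exp (s *\<^sub>R D1 r \<rho>) ** matrix_inv Umat) (Spt \<rho>))"

definition trajectory :: "(real \<Rightarrow> cpoint) \<Rightarrow> cpoint set" where
  "trajectory \<gamma> = range \<gamma>"

end

theory Submission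
  imports Defs
begin

text \<open>In the coordinates diagonalising \<open>D1\<close> the trajectory is the torus knot of all points
  \<open>[(A z^p, B z^q, C)]\<close> with \<open>|z| = 1\<close>, where \<open>p < q\<close> are coprime. A lift of any curve in it is
  \<open>\<mu> (A z^p, B z^q, C)\<close> with \<open>z' = \<zeta> z\<close>, and
  \<open>\<langle>\<Gamma>, \<Gamma>'\<rangle> = |\<mu>|\<^sup>2 \<zeta> (q |B|\<^sup>2 - p |A|\<^sup>2)\<close>,
  \<open>det (\<Gamma>, \<Gamma>', \<Gamma>'') = \<mu>^3 \<zeta>^3 z^(p+q) A B C p q (q - p)\<close>. The naturality conditions on these two
  quantities force \<open>\<zeta>\<close> to be a constant \<open>-i \<tau>\<close>, so \<open>\<mu>^3 z^(p+q)\<close> is constant and \<open>\<mu>\<close> is multiplied by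
  \<open>exp (2\<pi>i (p+q)/3)\<close> over the period \<open>2\<pi>/\<tau>\<close>; this holds for every natural parametrization of the
  knot. For the symmetrical configuration, \<open>p\<close> and \<open>q\<close> are \<open>-(n + 2m)\<close> and \<open>n - m\<close> divided by their
  greatest common divisor \<open>g\<close>, which divides 3, so \<open>g (p + q) = -3m\<close> and the anomaly is trivial
  unless \<open>g = 3\<close>, that is, \<open>m \<equiv> n\<close> modulo 3.\<close>

section \<open>The unitary change of coordinates\<close>

lemma inverse_sqrt2_square: "complex_of_real (1 / sqrt 2) * complex_of_real (1 / sqrt 2) = 1 / 2"
  by (simp flip: of_real_mult)

definition Uinv :: "complex^3^3" where
  "Uinv = vector [vector [of_real (1 / sqrt 2), 0, - \<i> * of_real (1 / sqrt 2)],
                  vector [0, 1, 0],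
                  vector [- \<i> * of_real (1 / sqrt 2), 0, of_real (1 / sqrt 2)]]"

lemma Umat_Uinv: "Umat ** Uinv = mat 1" "Uinv ** Umat = mat 1"
  using inverse_sqrt2_square
  by (simp_all add: vec_eq_iff forall_3 Umat_def Uinv_def matrix_matrix_mult_def sum_3 mat_def
      algebra_simps)

text \<open>\<open>matrix_inv\<close> is a choice operator, so it is identified through uniqueness
  of two-sided inverses.\<close>

lemma matrix_inv_Umat: "matrix_inv Umat = Uinv"
proof -
  have "Umat ** matrix_inv Umat = mat 1"
    unfolding matrix_inv_def using Umat_Uinv someI_ex[of "\<lambda>M. Umat ** M = mat 1 \<and> M ** Umat = mat 1"]
    by blast
  then have "Uinv ** (Umat ** matrix_inv Umat) = Uinv" by simp
  then show ?thesis by (simp add: matrix_mul_assoc Umat_Uinv)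
qed

lemma Uinv_Umat_vec [simp]: "Uinv *v (Umat *v x) = x" "Umat *v (Uinv *v x) = x"
  by (simp_all add: matrix_vector_mul_assoc Umat_Uinv)

lemma Umat_vec:
  "Umat *v x = vector [(x $ 1 + \<i> * x $ 3) * of_real (1 / sqrt 2), x $ 2,
                       (\<i> * x $ 1 + x $ 3) * of_real (1 / sqrt 2)]"
  by (simp add: vec_eq_iff forall_3 Umat_def matrix_vector_mult_def sum_3 algebra_simps)

text \<open>\<open>Umat\<close> pulls \<open>hmat\<close> back to diag(-1, 1, 1). In these
  coordinates the moduli and phases of the three entries separate.\<close>

lemma herm_Umat:
  "herm (Umat *v x) (Umat *v y) = - cnj (x $ 1) * y $ 1 + cnj (x $ 2) * y $ 2 + cnj (x $ 3) * y $ 3"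
proof -
  define h where "h = complex_of_real (1 / sqrt 2)"
  have h: "h * h = 1 / 2" "cnj h = h"
    using inverse_sqrt2_square by (auto simp: h_def)
  have h': "h * (h * a) = a / 2" for a
    using h(1) by (simp flip: mult.assoc)
  show ?thesis
    unfolding herm_def hmat_def Umat_vec h_def[symmetric]
    by (simp add: matrix_vector_mult_def sum_3 h h' algebra_simps)
qed

text \<open>The determinant of \<open>Umat\<close> is 1/2 + 1/2 = 1.\<close>

lemma det_Umat:
  "det (vector [Umat *v x, Umat *v y, Umat *v z] :: complex^3^3) = det (vector [x, y, z] :: complex^3^3)"
proof -
  define h where "h = complex_of_real (1 / sqrt 2)"
  have h: "h * h = 1 / 2"
    using inverse_sqrt2_square by (auto simp: h_def)
  have h': "h * (h * a) = a / 2" for a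
    using h(1) by (simp flip: mult.assoc)
  show ?thesis
    unfolding det_3 Umat_vec h_def[symmetric]
    by (simp add: h h' algebra_simps)
qed

lemma cproj_eq_iff:
  assumes "x \<noteq> 0" "y \<noteq> 0"
  shows "cproj x = cproj y \<longleftrightarrow> (\<exists>c. c \<noteq> 0 \<and> x = c *s y)"
proof
  assume "cproj x = cproj y"
  moreover have "x \<in> cproj x" by (simp add: cproj_def vec.span_base)
  ultimately have "x \<in> cproj y" by simp
  then obtain c where "x = c *s y" by (auto simp: cproj_def vec.span_singleton)
  with assms show "\<exists>c. c \<noteq> 0 \<and> x = c *s y" by (cases "c = 0") auto
next
  assume "\<exists>c. c \<noteq> 0 \<and> x = c *s y"
  then obtain c where c: "c \<noteq> 0" "x = c *s y" by blast
  then have "k *s x = (k * c) *s y" "k *s y = (k / c) *s x" for k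
    by simp_all
  then show "cproj x = cproj y"
    unfolding cproj_def vec.span_singleton by (safe; metis rangeI)
qed

lemma proj_act_cproj: "proj_act M (cproj x) = cproj (M *v x)"
  by (auto simp: proj_act_def cproj_def vec.span_singleton vector_scalar_commute image_image)

lemma has_vector_derivative_scale:
  fixes f :: "real \<Rightarrow> complex" and v :: "complex^3"
  assumes "(f has_vector_derivative f') F"
  shows "((\<lambda>t. f t *s v) has_vector_derivative f' *s v) F"
proof -
  have "linear (\<lambda>a::complex. a *s v)"
    by (rule linearI) (simp_all add: vec_eq_iff algebra_simps)
  then show ?thesis
    using assms bounded_linear.has_vector_derivative linear_conv_bounded_linear by blast
qed

text \<open>Splitting off constant vectors reduces differentiation of such curves to that of scalar
  functions.\<close>

lemma Umat_vector_columns: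
  "Umat *v vector [a, b, c] = a *s (Umat *v vector [1, 0, 0]) + b *s (Umat *v vector [0, 1, 0])
     + c *s (Umat *v vector [0, 0, 1])"
  by (simp add: Umat_vec vec_eq_iff forall_3 algebra_simps add_divide_distrib)

lemma has_vector_derivative_Umat:
  assumes "(f has_vector_derivative f') F" "(g has_vector_derivative g') F"
    "(h has_vector_derivative h') F"
  shows "((\<lambda>t. Umat *v vector [f t, g t, h t]) has_vector_derivative Umat *v vector [f', g', h']) F"
  unfolding Umat_vector_columns[of "f _"] Umat_vector_columns[of f']
  by (intro has_vector_derivative_add has_vector_derivative_scale assms)

lemma has_vector_derivative_component_Uinv:
  assumes "(f has_vector_derivative f') F"
  shows "((\<lambda>t. (Uinv *v f t) $ j) has_vector_derivative (Uinv *v f') $ j) F"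
proof -
  have "linear (\<lambda>x. (Uinv *v x) $ j)"
    by (rule linearI) (simp_all add: matrix_vector_mult_def sum.distrib scaleR_sum_right algebra_simps)
  then show ?thesis
    using assms bounded_linear.has_vector_derivative linear_conv_bounded_linear by blast
qed

section \<open>Logarithmic derivatives\<close>

text \<open>Derivatives are kept in the form \<open>k * f t\<close>, with \<open>k\<close> the
  logarithmic derivative. Products, powers and quotients then add, multiply and subtract the
  coefficients, and no branch of a logarithm has to be chosen.\<close>

lemma has_vector_derivative_mult_log:
  fixes f g :: "real \<Rightarrow> complex"
  assumes "(f has_vector_derivative k * f t) (at t)" "(g has_vector_derivative l * g t) (at t)"
  shows "((\<lambda>t. f t * g t) has_vector_derivative (k + l) * (f t * g t)) (at t)"
  using has_vector_derivative_mult[OF assms] by (simp add: algebra_simps)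

lemma has_vector_derivative_power_log:
  fixes f :: "real \<Rightarrow> complex"
  assumes "(f has_vector_derivative k * f t) (at t)"
  shows "((\<lambda>t. f t ^ n) has_vector_derivative (of_nat n * k) * f t ^ n) (at t)"
proof (induction n)
  case (Suc n)
  then show ?case
    using has_vector_derivative_mult_log[OF assms Suc] by (simp add: algebra_simps)
qed simp

lemma has_vector_derivative_divide_log:
  fixes f g :: "real \<Rightarrow> complex"
  assumes "(f has_vector_derivative k * f t) (at t)" "(g has_vector_derivative l * g t) (at t)"
    and "g t \<noteq> 0"
  shows "((\<lambda>t. f t / g t) has_vector_derivative (k - l) * (f t / g t)) (at t)"
proof -
  have "((\<lambda>t. f t / g t) has_derivative
     (\<lambda>h. - f t * (inverse (g t) * (h *\<^sub>R (l * g t)) * inverse (g t)) + (h *\<^sub>R (k * f t)) / g t)) (at t)"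
    using assms has_derivative_divide[of f "\<lambda>h. h *\<^sub>R (k * f t)" t UNIV g "\<lambda>h. h *\<^sub>R (l * g t)"]
    by (simp add: has_vector_derivative_def)
  moreover have "(\<lambda>h. - f t * (inverse (g t) * (h *\<^sub>R (l * g t)) * inverse (g t)) + (h *\<^sub>R (k * f t)) / g t)
     = (\<lambda>h. h *\<^sub>R ((k - l) * (f t / g t)))"
    using assms(3) by (auto simp: divide_simps scaleR_conv_of_real) (simp add: algebra_simps)
  ultimately show ?thesis by (simp add: has_vector_derivative_def)
qed

lemma exp_linear_log_derivative:
  fixes c :: complex
  shows "((\<lambda>t. exp (c * of_real t)) has_vector_derivative c * exp (c * of_real t)) (at t)"
  by (rule has_vector_derivative_real_field) (auto intro!: derivative_eq_intros)

text \<open>The quotient of \<open>f\<close> by the exponential has logarithmic derivative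
  \<open>c - c = 0\<close>.\<close>

lemma constant_log_derivative:
  fixes f :: "real \<Rightarrow> complex"
  assumes "\<And>t. (f has_vector_derivative c * f t) (at t)"
  shows "f t = f 0 * exp (c * of_real t)"
proof -
  have "((\<lambda>t. f t / exp (c * of_real t)) has_vector_derivative 0) (at t)" for t
    using has_vector_derivative_divide_log[OF assms[of t] exp_linear_log_derivative[of c]] by simp
  then obtain d where "f t / exp (c * of_real t) = d" for t
    using has_vector_derivative_zero_constant[of UNIV "\<lambda>t. f t / exp (c * of_real t)"] by auto
  from this[of t] this[of 0] show ?thesis by (simp add: field_simps)
qed

lemma vderiv_Umat:
  assumes "\<And>t. (f has_vector_derivative f' t) (at t)" "\<And>t. (g has_vector_derivative g' t) (at t)"
    "\<And>t. (h has_vector_derivative h' t) (at t)"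
  shows "vderiv (\<lambda>t. Umat *v vector [f t, g t, h t]) = (\<lambda>t. Umat *v vector [f' t, g' t, h' t])"
  unfolding vderiv_def
  by (intro ext vector_derivative_at has_vector_derivative_Umat assms)

lemma second_log_derivative:
  fixes f k :: "real \<Rightarrow> complex"
  assumes "(f has_vector_derivative k t * f t) (at t)" "(k has_vector_derivative k' t) (at t)"
  shows "((\<lambda>t. k t * f t) has_vector_derivative (k' t + (k t)\<^sup>2) * f t) (at t)"
  using has_vector_derivative_mult[OF assms(2,1)] by (simp add: algebra_simps power2_eq_square)

lemma minimal_period_unique:
  assumes "minimal_period \<gamma> \<omega>" "minimal_period \<gamma> \<omega>'"
  shows "\<omega> = \<omega>'"
  using assms by (meson minimal_period_def order_antisym)

section \<open>Natural parametrizations of torus knots\<close>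

text \<open>\<open>null\<close> puts the points with \<open>norm z = 1\<close> on the hyperquadric.
  \<open>positive\<close> makes the knot positively transversal when \<open>z\<close> runs
  clockwise. Coprimality makes \<open>z\<close> recoverable from \<open>z ^ p\<close> and
  \<open>z ^ q\<close>.\<close>

locale torus_knot =
  fixes A B C :: complex and p q :: nat
  assumes nonzero: "A \<noteq> 0" "B \<noteq> 0" "C \<noteq> 0"
    and p_pos: "0 < p" and p_less_q: "p < q" and coprime_pq: "coprime p q"
    and null: "(norm B)\<^sup>2 + (norm C)\<^sup>2 = (norm A)\<^sup>2"
    and positive: "q * (norm B)\<^sup>2 < p * (norm A)\<^sup>2"
begin

definition torus_vec :: "complex \<Rightarrow> complex^3" where
  "torus_vec z = Umat *v vector [A * z ^ p, B * z ^ q, C]"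

definition pt :: "complex \<Rightarrow> cpoint" where
  "pt z = cproj (torus_vec z)"

definition knot :: "cpoint set" where
  "knot = pt ` {z. norm z = 1}"

text \<open>Both naturality conditions hold exactly when \<open>|\<mu>| = M / \<delta>\<close> and \<open>\<zeta> = -i \<tau>\<close>, up to the phase of \<open>\<mu>\<close>.\<close>

definition \<delta> :: real where
  "\<delta> = p * (norm A)\<^sup>2 - q * (norm B)\<^sup>2"

definition E :: real where
  "E = norm (A * B * C) * (p * q * (q - p))"

definition M :: real where
  "M = root 3 E"

text \<open>With \<open>c = M / \<delta>\<close> for the modulus of \<open>\<mu>\<close>, this
  solves the two norm equations \<open>c ^ 2 * \<delta> * \<tau> = 1\<close> and
  \<open>c ^ 3 * \<tau> ^ 3 * E = 1\<close>.\<close>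

definition \<tau> :: real where
  "\<tau> = \<delta> / M\<^sup>2"

lemma \<delta>_pos: "\<delta> > 0"
  using positive by (simp add: \<delta>_def)

lemma E_pos: "E > 0"
  using nonzero p_pos p_less_q by (auto simp: E_def)

lemma M_pos: "M > 0"
  using E_pos by (simp add: M_def)

lemma M_cube: "M ^ 3 = E"
  using E_pos by (simp add: M_def)

lemma \<tau>_pos: "\<tau> > 0"
  using \<delta>_pos M_pos by (simp add: \<tau>_def)

section \<open>Null vectors and points on the torus knot\<close>

lemma scale_torus_vec:
  "\<mu> *s torus_vec z = Umat *v vector [A * (\<mu> * z ^ p), B * (\<mu> * z ^ q), C * \<mu>]"
  by (simp add: torus_vec_def Umat_vec vec_eq_iff forall_3 algebra_simps)

lemma herm_torus_vec:
  assumes "norm z = 1"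
  shows "herm (torus_vec z) (torus_vec z) = 0"
proof -
  have "cnj (A * z ^ p) * (A * z ^ p) = of_real ((norm A)\<^sup>2)"
    "cnj (B * z ^ q) * (B * z ^ q) = of_real ((norm B)\<^sup>2)"
    "cnj C * C = of_real ((norm C)\<^sup>2)"
    using assms by (simp_all only: complex_norm_square[symmetric] mult.commute[of "cnj _"] norm_mult norm_power) simp_all
  then show ?thesis
    unfolding torus_vec_def herm_Umat using arg_cong[OF null, of complex_of_real]
    by (simp add: algebra_simps)
qed

lemma torus_vec_nonzero: "torus_vec z \<noteq> 0"
proof
  assume "torus_vec z = 0"
  then have "Uinv *v torus_vec z = 0" by simp
  then show False
    using nonzero by (simp add: torus_vec_def vec_eq_iff forall_3)
qed

lemma scale_torus_vec_null:
  assumes "norm z = 1" "\<mu> \<noteq> 0"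
  shows "\<mu> *s torus_vec z \<in> null_vectors"
proof -
  have "herm (\<mu> *s torus_vec z) (\<mu> *s torus_vec z) = cnj \<mu> * \<mu> * herm (torus_vec z) (torus_vec z)"
    unfolding herm_def by (simp add: sum_distrib_left vector_scalar_commute algebra_simps)
  then show ?thesis
    using assms herm_torus_vec torus_vec_nonzero by (simp add: null_vectors_def)
qed

text \<open>Natural coefficients allow \<open>z = (z ^ p) ^ u / (z ^ q) ^ w\<close> to be used
  without integer exponents.\<close>

lemma bezout_pq: obtains u w where "p * u = q * w + 1"
  using bezout_nat[of p q] p_pos coprime_pq by (metis coprime_imp_gcd_eq_1 less_irrefl)

text \<open>The constant third coordinate \<open>C\<close> forces the projective factor to be 1. The
  powers \<open>p\<close> and \<open>q\<close> of the two numbers then agree, and Bezout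
  finishes.\<close>

lemma pt_inj:
  assumes "norm z = 1" "norm z' = 1" "pt z = pt z'"
  shows "z = z'"
proof -
  obtain c where c: "c \<noteq> 0" "torus_vec z = c *s torus_vec z'"
    using assms(3) torus_vec_nonzero by (auto simp: pt_def cproj_eq_iff)
  then have "Uinv *v torus_vec z = Uinv *v (c *s torus_vec z')" by simp
  then have e: "vector [A * z ^ p, B * z ^ q, C]
      = (vector [A * (c * z' ^ p), B * (c * z' ^ q), C * c] :: complex^3)"
    by (simp only: scale_torus_vec) (simp add: torus_vec_def)
  then have "c = 1" using nonzero by (simp add: vec_eq_iff forall_3)
  with e have eq: "z ^ p = z' ^ p" "z ^ q = z' ^ q"
    using nonzero by (simp_all add: vec_eq_iff forall_3)
  obtain u w where uw: "p * u = q * w + 1" using bezout_pq .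
  have "z ^ (q * w) = z' ^ (q * w)" "z ^ (q * w + 1) = z' ^ (q * w + 1)"
    using eq by (simp_all only: uw[symmetric] power_mult)
  then show "z = z'"
    using assms(1,2) by (metis mult_cancel_left norm_zero power_add power_eq_0_iff power_one_right zero_neq_one)
qed

text \<open>The coordinates are constants times \<open>x a = \<mu> * z ^ a\<close> for
  \<open>a = p, q, 0\<close>, with logarithmic derivative \<open>k a = l + a * \<zeta>\<close>. In
  the Hermitian product the terms in \<open>l\<close> cancel by \<open>null\<close>. In the
  determinant the derivatives \<open>k' a\<close> drop out because they are affine in
  \<open>a\<close>, as \<open>k a\<close> is. A Vandermonde determinant in \<open>l\<close>,
  \<open>l + p * \<zeta>\<close>, \<open>l + q * \<zeta>\<close> remains.\<close>

lemma
  assumes \<mu>: "\<And>t. (\<mu> has_vector_derivative l t * \<mu> t) (at t)"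
    and l: "\<And>t. (l has_vector_derivative l' t) (at t)"
    and z: "\<And>t. (z has_vector_derivative \<zeta> t * z t) (at t)"
    and \<zeta>: "\<And>t. (\<zeta> has_vector_derivative \<zeta>' t) (at t)"
    and z1: "\<And>t. norm (z t) = 1"
  defines "\<Gamma> \<equiv> \<lambda>t. \<mu> t *s torus_vec (z t)"
  shows herm_frame: "herm (\<Gamma> t) (vderiv \<Gamma> t) = - of_real ((norm (\<mu> t))\<^sup>2 * \<delta>) * \<zeta> t"
    and lift_det_frame: "lift_det \<Gamma> t
      = \<mu> t ^ 3 * z t ^ (p + q) * \<zeta> t ^ 3 * (A * B * C * (p * q * (q - p)))"
proof -
  define x where "x a t = \<mu> t * z t ^ a" for a t
  define k where "k a t = l t + of_nat a * \<zeta> t" for a t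
  define k' where "k' a t = l' t + of_nat a * \<zeta>' t" for a t
  have x: "(x a has_vector_derivative k a t * x a t) (at t)" for a t
    unfolding x_def k_def
    using has_vector_derivative_mult_log[OF \<mu> has_vector_derivative_power_log[OF z]] by simp
  have k: "(k a has_vector_derivative k' a t) (at t)" for a t
    unfolding k_def k'_def
    using has_vector_derivative_add[OF l has_vector_derivative_mult_right[OF \<zeta>]] by simp
  note x' = second_log_derivative[of "x _" "k _", OF x k]
  have G: "\<Gamma> = (\<lambda>t. Umat *v vector [A * x p t, B * x q t, C * x 0 t])"
    by (simp add: \<Gamma>_def scale_torus_vec x_def)
  have G': "vderiv \<Gamma> = (\<lambda>t. Umat *v vector [A * (k p t * x p t), B * (k q t * x q t), C * (k 0 t * x 0 t)])"
    unfolding G by (intro vderiv_Umat has_vector_derivative_mult_right x)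
  have G'': "vderiv (vderiv \<Gamma>) = (\<lambda>t. Umat *v vector [A * ((k' p t + (k p t)\<^sup>2) * x p t),
       B * ((k' q t + (k q t)\<^sup>2) * x q t), C * ((k' 0 t + (k 0 t)\<^sup>2) * x 0 t)])"
    unfolding G' by (intro vderiv_Umat has_vector_derivative_mult_right x')
  have xx: "cnj (c * x a t) * (c * (k a t * x a t)) = of_real ((norm (\<mu> t))\<^sup>2 * (norm c)\<^sup>2) * k a t" for c a
  proof -
    have "cnj (c * x a t) * (c * (k a t * x a t)) = ((c * x a t) * cnj (c * x a t)) * k a t"
      by (simp add: algebra_simps)
    also have "(c * x a t) * cnj (c * x a t) = of_real ((norm (\<mu> t))\<^sup>2 * (norm c)\<^sup>2)"
      by (simp only: complex_norm_square[symmetric] x_def norm_mult norm_power z1)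
         (simp add: power_mult_distrib)
    finally show ?thesis .
  qed
  have nA: "(norm A)\<^sup>2 = (norm B)\<^sup>2 + (norm C)\<^sup>2" using null by simp
  have "herm (\<Gamma> t) (vderiv \<Gamma> t) = - (of_real ((norm (\<mu> t))\<^sup>2 * (norm A)\<^sup>2) * k p t)
      + of_real ((norm (\<mu> t))\<^sup>2 * (norm B)\<^sup>2) * k q t + of_real ((norm (\<mu> t))\<^sup>2 * (norm C)\<^sup>2) * k 0 t"
    unfolding G' unfolding G herm_Umat by (simp only: vector_3 mult_minus_left xx)
  also have "\<dots> = - of_real ((norm (\<mu> t))\<^sup>2 * \<delta>) * \<zeta> t"
    by (simp add: k_def \<delta>_def nA algebra_simps)
  finally show "herm (\<Gamma> t) (vderiv \<Gamma> t) = - of_real ((norm (\<mu> t))\<^sup>2 * \<delta>) * \<zeta> t" .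
  have "lift_det \<Gamma> t = (A * x p t) * (B * x q t) * (C * x 0 t) * 
     ((k q t - k 0 t) * (k' 0 t + (k 0 t)\<^sup>2 - k' p t - (k p t)\<^sup>2)
      - (k p t - k 0 t) * (k' 0 t + (k 0 t)\<^sup>2 - k' q t - (k q t)\<^sup>2))"
    unfolding lift_det_def G'' unfolding G' unfolding G det_Umat
    unfolding det_3 by (simp add: algebra_simps)
  also have "(k q t - k 0 t) * (k' 0 t + (k 0 t)\<^sup>2 - k' p t - (k p t)\<^sup>2)
      - (k p t - k 0 t) * (k' 0 t + (k 0 t)\<^sup>2 - k' q t - (k q t)\<^sup>2)
     = \<zeta> t ^ 3 * (of_nat p * of_nat q * (of_nat q - of_nat p))"
    by (simp add: k_def k'_def) algebra
  also have "(A * x p t) * (B * x q t) * (C * x 0 t) = A * B * C * \<mu> t ^ 3 * z t ^ (p + q)"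
    by (simp add: x_def power_add power3_eq_cube)
  finally show "lift_det \<Gamma> t
      = \<mu> t ^ 3 * z t ^ (p + q) * \<zeta> t ^ 3 * (A * B * C * (p * q * (q - p)))"
    using p_less_q by (simp add: of_nat_diff)
qed

text \<open>Here \<open>z\<close> and the factor \<open>\<mu>\<close> are only known pointwise.
  Their differentiability is recovered from the smooth, nowhere zero coordinates \<open>v j\<close>
  of the lift: \<open>\<mu>\<close> is \<open>v 3 / C\<close>, and \<open>z\<close> is a Bezout
  expression in the quotients \<open>v 1 / v 3\<close> and \<open>v 2 / v 3\<close>.\<close>

lemma lift_frame:
  assumes lift: "is_lift \<Gamma> \<gamma>" and z: "\<And>t. norm (z t) = 1" "\<And>t. \<gamma> t = pt (z t)"
  obtains \<mu> l l' \<zeta> \<zeta>' where "\<Gamma> = (\<lambda>t. \<mu> t *s torus_vec (z t))" "\<And>t. \<mu> t \<noteq> 0"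
    "\<And>t. (\<mu> has_vector_derivative l t * \<mu> t) (at t)" "\<And>t. (l has_vector_derivative l' t) (at t)"
    "\<And>t. (z has_vector_derivative \<zeta> t * z t) (at t)" "\<And>t. (\<zeta> has_vector_derivative \<zeta>' t) (at t)"
proof -
  obtain D where D0: "\<And>t. D 0 t = \<Gamma> t"
    and D: "\<And>k t. (D k has_vector_derivative D (Suc k) t) (at t)"
    using lift by (auto simp: is_lift_def smooth_on_def)
  have "\<exists>c. c \<noteq> 0 \<and> \<Gamma> t = c *s torus_vec (z t)" for t
  proof -
    have "cproj (\<Gamma> t) = cproj (torus_vec (z t))" "\<Gamma> t \<noteq> 0"
      using lift z(2)[of t] by (auto simp: is_lift_def null_vectors_def pt_def)
    then show ?thesis using cproj_eq_iff torus_vec_nonzero by blast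
  qed
  then obtain \<mu> where \<mu>: "\<And>t. \<mu> t \<noteq> 0" "\<And>t. \<Gamma> t = \<mu> t *s torus_vec (z t)" by metis
  define v where "v j t = (Uinv *v D 0 t) $ j" for j t
  define d where "d j t = (Uinv *v D 1 t) $ j" for j t
  define k where "k j t = d j t / v j t" for j t
  have v_eq: "v 1 t = A * (\<mu> t * z t ^ p)" "v 2 t = B * (\<mu> t * z t ^ q)" "v 3 t = C * \<mu> t" for t
    by (simp_all add: v_def D0 \<mu>(2) scale_torus_vec)
  have z0: "z t \<noteq> 0" for t using z(1)[of t] by auto
  have v0: "v j t \<noteq> 0" for j t
    using nonzero \<mu>(1) z0 exhaust_3[of j] by (auto simp: v_eq)
  have dv: "(v j has_vector_derivative d j t) (at t)" for j t
    using has_vector_derivative_component_Uinv[OF D[of 0 t]] by (simp add: v_def[abs_def] d_def)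
  then have v': "(v j has_vector_derivative k j t * v j t) (at t)" for j t
    using v0 by (simp add: k_def)
  have "d j differentiable at t" "v j differentiable at t" for j t
    using has_vector_derivative_component_Uinv[OF D[of "1" t]] dv
    by (auto simp: d_def[abs_def] intro: differentiableI_vector)
  then have k: "k j differentiable at t" for j t
    unfolding k_def[abs_def] using v0 by (intro differentiable_divide)
  obtain u w where uw: "p * u = q * w + 1" using bezout_pq .
  \<comment> \<open>The logarithmic derivative of \<open>(v 1 / v 3) ^ u / (v 2 / v 3) ^ w\<close>,
    which is a constant multiple of \<open>z\<close>.\<close>
  define \<zeta> where "\<zeta> t = of_nat u * (k 1 t - k 3 t) - of_nat w * (k 2 t - k 3 t)" for t
  have "((\<lambda>t. (v 1 t / v 3 t) ^ u / (v 2 t / v 3 t) ^ w) has_vector_derivative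
     \<zeta> t * ((v 1 t / v 3 t) ^ u / (v 2 t / v 3 t) ^ w)) (at t)" for t
    unfolding \<zeta>_def
    by (intro has_vector_derivative_divide_log has_vector_derivative_power_log v') (use v0 in auto)
  \<comment> \<open>This factor removes \<open>A\<close>, \<open>B\<close>, \<open>C\<close> from
    the quotients, leaving exactly \<open>z\<close>.\<close>
  from has_vector_derivative_mult_right[OF this, of "(C / A) ^ u / (C / B) ^ w"]
  have "((\<lambda>t. (C / A) ^ u / (C / B) ^ w * ((v 1 t / v 3 t) ^ u / (v 2 t / v 3 t) ^ w)) has_vector_derivative
     \<zeta> t * ((C / A) ^ u / (C / B) ^ w * ((v 1 t / v 3 t) ^ u / (v 2 t / v 3 t) ^ w))) (at t)" for t
    by (simp only: mult.left_commute)
  moreover have "(C / A) ^ u / (C / B) ^ w * ((v 1 t / v 3 t) ^ u / (v 2 t / v 3 t) ^ w) = z t" for t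
  proof -
    have "(C / A) ^ u / (C / B) ^ w * ((v 1 t / v 3 t) ^ u / (v 2 t / v 3 t) ^ w)
       = ((C / A) * (v 1 t / v 3 t)) ^ u / ((C / B) * (v 2 t / v 3 t)) ^ w"
      by (simp add: power_mult_distrib power_divide mult_ac)
    also have "(C / A) * (v 1 t / v 3 t) = z t ^ p"
      using nonzero \<mu>(1)[of t] by (simp add: v_eq)
    also have "(C / B) * (v 2 t / v 3 t) = z t ^ q"
      using nonzero \<mu>(1)[of t] by (simp add: v_eq)
    also have "(z t ^ p) ^ u / (z t ^ q) ^ w = z t"
      using z0 by (simp add: uw flip: power_mult)
    finally show ?thesis .
  qed
  ultimately have z': "(z has_vector_derivative \<zeta> t * z t) (at t)" for t
    by (simp only:)
  have \<mu>': "(\<mu> has_vector_derivative k 3 t * \<mu> t) (at t)" for t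
    using has_vector_derivative_mult_right[OF v'[of 3 t], of "1 / C"] nonzero by (simp add: v_eq)
  have "\<zeta> differentiable at t" for t
    unfolding \<zeta>_def[abs_def] by (intro derivative_intros k)
  then show ?thesis
    using that[OF _ \<mu>(1) \<mu>' _ z', of "\<lambda>t. vector_derivative (k 3) (at t)" "\<lambda>t. vector_derivative \<zeta> (at t)"] \<mu>(2) k
    by (auto simp: vector_derivative_works)
qed

text \<open>The Hermitian condition makes \<open>\<zeta>\<close> a negative multiple of the
  imaginary unit, of modulus \<open>1 / (c ^ 2 * \<delta>)\<close> with
  \<open>c = norm (\<mu> t)\<close>. Taking norms in the determinant condition then determines
  \<open>c\<close>, and with it \<open>\<zeta>\<close>.\<close>

lemma natural_speed:
  assumes \<Gamma>: "wilczynski_lift \<Gamma> \<gamma>" "\<And>t. \<i> * inverse (herm (\<Gamma> t) (vderiv \<Gamma> t)) = 1"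
    and z: "\<And>t. norm (z t) = 1" "\<And>t. \<gamma> t = pt (z t)"
  shows "(z has_vector_derivative - \<i> * of_real \<tau> * z t) (at t)"
proof -
  have lift: "is_lift \<Gamma> \<gamma>" and det: "lift_det \<Gamma> t = -1" for t
    using \<Gamma>(1) by (auto simp: wilczynski_lift_def)
  obtain \<mu> l l' \<zeta> \<zeta>' where f: "\<Gamma> = (\<lambda>t. \<mu> t *s torus_vec (z t))" "\<And>t. \<mu> t \<noteq> 0"
    "\<And>t. (\<mu> has_vector_derivative l t * \<mu> t) (at t)" "\<And>t. (l has_vector_derivative l' t) (at t)"
    "\<And>t. (z has_vector_derivative \<zeta> t * z t) (at t)" "\<And>t. (\<zeta> has_vector_derivative \<zeta>' t) (at t)"
    by (rule lift_frame[OF lift z]) blast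
  define c where "c = norm (\<mu> t)"
  have c: "c > 0" using f(2) by (simp add: c_def)
  have "- of_real (c\<^sup>2 * \<delta>) * \<zeta> t = herm (\<Gamma> t) (vderiv \<Gamma> t)"
    using herm_frame[OF f(3-6) z(1)] by (simp add: f(1) c_def)
  \<comment> \<open>The product cannot vanish: \<open>inverse 0 = 0\<close> would contradict the
    naturality condition.\<close>
  also have "\<dots> = \<i>"
    using \<Gamma>(2)[of t] by (cases "herm (\<Gamma> t) (vderiv \<Gamma> t) = 0") (auto simp: field_simps)
  finally have "of_real (c\<^sup>2 * \<delta>) * \<zeta> t = - \<i>" by (simp add: minus_equation_iff)
  then have \<zeta>: "\<zeta> t = - \<i> * of_real (1 / (c\<^sup>2 * \<delta>))"
    using c \<delta>_pos by (simp add: field_simps)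
  then have n\<zeta>: "norm (\<zeta> t) = 1 / (c\<^sup>2 * \<delta>)"
    using c \<delta>_pos by (simp only: norm_mult norm_minus_cancel norm_of_real) simp
  have "\<mu> t ^ 3 * z t ^ (p + q) * \<zeta> t ^ 3 * (A * B * C * (p * q * (q - p))) = -1"
    using lift_det_frame[OF f(3-6) z(1), of t] det[of t] by (simp add: f(1))
  then have "norm (\<mu> t ^ 3 * z t ^ (p + q) * \<zeta> t ^ 3 * (A * B * C * of_nat (p * q * (q - p)))) = 1"
    by simp
  then have "c ^ 3 * (1 / (c\<^sup>2 * \<delta>)) ^ 3 * E = 1"
    unfolding norm_mult norm_power n\<zeta> z(1) norm_of_nat c_def[symmetric] using p_less_q by (simp add: E_def norm_mult of_nat_diff)
  then have "E = (c * \<delta>) ^ 3"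
    using c \<delta>_pos by (simp add: field_simps power2_eq_square power3_eq_cube)
  then have "M = c * \<delta>"
    using c \<delta>_pos unfolding M_def by (simp add: real_root_power_cancel)
  then have "1 / (c\<^sup>2 * \<delta>) = \<tau>"
    using c \<delta>_pos by (simp add: \<tau>_def field_simps power2_eq_square)
  then show ?thesis using f(5)[of t] \<zeta> by simp
qed

text \<open>With \<open>\<zeta>\<close> constant, the determinant condition makes
  \<open>\<mu> ^ 3 * z ^ (p + q)\<close> constant. Hence \<open>3 * l\<close> is the constant
  \<open>\<i> * \<tau> * (p + q)\<close> and \<open>\<mu>\<close> is an exponential, while
  \<open>z\<close> returns after time \<open>2 * pi / \<tau>\<close>. The statement covers every
  Wilczynski lift, which gives uniqueness in \<open>curve_eps\<close>.\<close>

lemma wilczynski_lift_rotates: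
  assumes \<Gamma>: "wilczynski_lift \<Gamma> \<gamma>"
    and z: "\<And>t. norm (z t) = 1" "\<And>t. \<gamma> t = pt (z t)"
    and speed: "\<And>t. (z has_vector_derivative - \<i> * of_real \<tau> * z t) (at t)"
  shows "\<Gamma> (2 * pi / \<tau>) = cis (2 * pi * (p + q) / 3) *s \<Gamma> 0"
proof -
  have lift: "is_lift \<Gamma> \<gamma>" and det: "lift_det \<Gamma> t = -1" for t
    using \<Gamma>(1) by (auto simp: wilczynski_lift_def)
  obtain \<mu> l l' \<zeta> \<zeta>' where f: "\<Gamma> = (\<lambda>t. \<mu> t *s torus_vec (z t))" "\<And>t. \<mu> t \<noteq> 0"
    "\<And>t. (\<mu> has_vector_derivative l t * \<mu> t) (at t)" "\<And>t. (l has_vector_derivative l' t) (at t)"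
    "\<And>t. (z has_vector_derivative \<zeta> t * z t) (at t)" "\<And>t. (\<zeta> has_vector_derivative \<zeta>' t) (at t)"
    by (rule lift_frame[OF lift z]) blast
  have z0: "z t \<noteq> 0" for t using z(1)[of t] by auto
  have \<zeta>: "\<zeta> t = - \<i> * of_real \<tau>" for t
    using vector_derivative_unique_at[OF f(5) speed, of t] unfolding mult_right_cancel[OF z0] .
  define c where "c = (- \<i> * of_real \<tau>) ^ 3 * (A * B * C * of_nat (p * q * (q - p)))"
  have eq: "a = - (1 / c)" if "a * c = -1" for a
  proof -
    have "c \<noteq> 0" using that by auto
    then have "a = a * c / c" by simp
    then show ?thesis using that by simp
  qed
  have "\<mu> t ^ 3 * z t ^ (p + q) * c = -1" for t
    using lift_det_frame[OF f(3-6) z(1), of t] det[of t] by (simp add: f(1) \<zeta> c_def mult.assoc)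
  then have const: "\<mu> t ^ 3 * z t ^ (p + q) = - (1 / c)" for t
    by (rule eq)
  have "((\<lambda>t. \<mu> t ^ 3 * z t ^ (p + q)) has_vector_derivative
     (of_nat 3 * l t + of_nat (p + q) * (- \<i> * of_real \<tau>)) * (\<mu> t ^ 3 * z t ^ (p + q))) (at t)" for t
    by (intro has_vector_derivative_mult_log has_vector_derivative_power_log f(3) speed)
  then have "(of_nat 3 * l t + of_nat (p + q) * (- \<i> * of_real \<tau>)) * (\<mu> t ^ 3 * z t ^ (p + q)) = 0" for t
    unfolding const by (rule vector_derivative_unique_at) (rule has_vector_derivative_const)
  then have "of_nat 3 * l t + of_nat (p + q) * (- \<i> * of_real \<tau>) = 0" for t
    using f(2) z0 by simp
  then have l: "l t = \<i> * of_real (\<tau> * (p + q) / 3)" for t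
    by (simp add: field_simps)
  have "\<mu> (2 * pi / \<tau>) = \<mu> 0 * exp (\<i> * of_real (\<tau> * (p + q) / 3) * of_real (2 * pi / \<tau>))"
    using f(3) unfolding l by (rule constant_log_derivative)
  also have "\<i> * of_real (\<tau> * (p + q) / 3) * of_real (2 * pi / \<tau>) = \<i> * of_real (2 * pi * (p + q) / 3)"
    using \<tau>_pos by (simp add: field_simps)
  finally have \<mu>: "\<mu> (2 * pi / \<tau>) = cis (2 * pi * (p + q) / 3) * \<mu> 0"
    by (simp add: cis_conv_exp)
  have "z (2 * pi / \<tau>) = z 0 * exp (- \<i> * of_real \<tau> * of_real (2 * pi / \<tau>))"
    using speed by (rule constant_log_derivative)
  also have "- \<i> * of_real \<tau> * of_real (2 * pi / \<tau>) = - (\<i> * of_real (2 * pi))"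
    using \<tau>_pos by simp
  also have "exp \<dots> = 1"
    by (simp only: exp_minus cis_conv_exp[symmetric] cis_2pi inverse_1)
  finally show ?thesis by (simp add: f(1) \<mu>)
qed

section \<open>Periods and injectivity\<close>

lemma pt_eq_iff:
  assumes z: "\<And>t. norm (z t) = 1"
    and speed: "\<And>t. (z has_vector_derivative - \<i> * of_real \<tau> * z t) (at t)"
  shows "pt (z s) = pt (z t) \<longleftrightarrow> (\<exists>k::int. s - t = of_int k * (2 * pi / \<tau>))"
proof -
  have z0: "z 0 \<noteq> 0" using z[of 0] by auto
  have "pt (z s) = pt (z t) \<longleftrightarrow> z s = z t"
    using pt_inj[OF z z] by metis
  also have "\<dots> \<longleftrightarrow> exp (- \<i> * of_real \<tau> * of_real s) = exp (- \<i> * of_real \<tau> * of_real t)"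
    using constant_log_derivative[OF speed, of s] constant_log_derivative[OF speed, of t] z0 by simp
  also have "\<dots> \<longleftrightarrow> (\<exists>k::int. - \<i> * of_real \<tau> * of_real s = - \<i> * of_real \<tau> * of_real t + (of_int (2 * k) * pi) * \<i>)"
    by (rule exp_eq)
  also have "\<dots> \<longleftrightarrow> (\<exists>k::int. s - t = - of_int k * (2 * pi / \<tau>))"
  proof (intro ex_cong1)
    fix k :: int
    have "- \<i> * of_real \<tau> * of_real s = - \<i> * of_real \<tau> * of_real t + (of_int (2 * k) * pi) * \<i>
       \<longleftrightarrow> - \<tau> * s = - \<tau> * t + 2 * k * pi"
      by (simp add: complex_eq_iff)
    also have "\<dots> \<longleftrightarrow> s - t = - of_int k * (2 * pi / \<tau>)"
      using \<tau>_pos by (auto simp: field_simps)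
    finally show "(- \<i> * of_real \<tau> * of_real s = - \<i> * of_real \<tau> * of_real t + (of_int (2 * k) * pi) * \<i>)
      \<longleftrightarrow> s - t = - of_int k * (2 * pi / \<tau>)" .
  qed
  also have "\<dots> \<longleftrightarrow> (\<exists>k::int. s - t = of_int k * (2 * pi / \<tau>))"
    by (metis minus_minus of_int_minus)
  finally show ?thesis .
qed

text \<open>Coinciding points have parameters differing by an integer multiple of the period, and
  the only multiple smaller than the period in modulus is 0.\<close>

lemma
  assumes z: "\<And>t. norm (z t) = 1"
    and speed: "\<And>t. (z has_vector_derivative - \<i> * of_real \<tau> * z t) (at t)"
  shows minimal_period_pt: "minimal_period (\<lambda>t. pt (z t)) (2 * pi / \<tau>)"
    and inj_on_pt: "inj_on (\<lambda>t. pt (z t)) {0..<2 * pi / \<tau>}"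
proof -
  define \<omega> where "\<omega> = 2 * pi / \<tau>"
  have \<omega>: "\<omega> > 0" using \<tau>_pos by (simp add: \<omega>_def)
  note eq = pt_eq_iff[OF z speed, folded \<omega>_def]
  have small: "k = 0" if "\<bar>of_int k * \<omega>\<bar> < \<omega>" for k :: int
  proof -
    have "\<bar>of_int k\<bar> * \<omega> < 1 * \<omega>" using that \<omega> by (simp add: abs_mult)
    then have "\<bar>real_of_int k\<bar> < 1" using \<omega> mult_less_cancel_right_pos by blast
    then show ?thesis by linarith
  qed
  have "\<omega> \<le> x" if x: "x > 0" and per: "\<forall>t. pt (z (t + x)) = pt (z t)" for x
  proof (rule ccontr)
    assume "\<not> \<omega> \<le> x"
    obtain k :: int where k: "x = of_int k * \<omega>" using per[rule_format, of 0] eq[of x 0] by (metis add_0 diff_zero)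
    have "k = 0" using \<open>\<not> \<omega> \<le> x\<close> x by (intro small) (simp flip: k)
    with k x show False by simp
  qed
  moreover have "pt (z (t + \<omega>)) = pt (z t)" for t
    unfolding eq by (rule exI[of _ 1]) simp
  ultimately show "minimal_period (\<lambda>t. pt (z t)) (2 * pi / \<tau>)"
    using \<omega> by (auto simp: minimal_period_def simp flip: \<omega>_def)
  show "inj_on (\<lambda>t. pt (z t)) {0..<2 * pi / \<tau>}"
    unfolding \<omega>_def[symmetric]
  proof (rule inj_onI)
    fix s t assume st: "s \<in> {0..<\<omega>}" "t \<in> {0..<\<omega>}" "pt (z s) = pt (z t)"
    then obtain k :: int where k: "s - t = of_int k * \<omega>" using eq by auto
    moreover have "\<bar>s - t\<bar> < \<omega>" using st by auto
    ultimately show "s = t" using small[of k] by auto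
  qed
qed

end

section \<open>Existence of a natural parametrization and the value of
  \<open>knot_eps\<close>\<close>

lemma smooth_on_Umat_exp:
  "smooth_on UNIV (\<lambda>t. Umat *v vector [a * exp (k * of_real t), b * exp (l * of_real t), c * exp (m * of_real t)])"
proof -
  have *: "((\<lambda>t. x ^ j * a * exp (x * of_real t)) has_vector_derivative x ^ Suc j * a * exp (x * of_real t)) (at t)"
    for x a :: complex and j t
    using has_vector_derivative_mult_right[OF exp_linear_log_derivative[of x t], of "x ^ j * a"]
    by (simp add: mult_ac)
  show ?thesis
    unfolding smooth_on_def
    by (rule exI[of _ "\<lambda>j t. Umat *v vector [k ^ j * a * exp (k * of_real t),
          l ^ j * b * exp (l * of_real t), m ^ j * c * exp (m * of_real t)]"])
       (use has_vector_derivative_Umat[OF * * *] in simp)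
qed

lemma cube_root_exists:
  fixes x :: complex
  obtains y where "y ^ 3 = x"
proof (cases "x = 0")
  case False
  have "exp (Ln x / 3) ^ 3 = x"
    using False by (simp flip: exp_of_nat_mult)
  then show ?thesis using that by blast
qed (use that[of 0] in simp)

lemma range_exp_circle:
  assumes "\<kappa> \<noteq> 0"
  shows "range (\<lambda>t. exp (- \<i> * of_real \<kappa> * of_real t)) = {w. norm w = 1}"
proof (intro set_eqI iffI)
  fix w :: complex assume "w \<in> {w. norm w = 1}"
  then have "w = exp (\<i> * of_real (Arg w))"
    using Arg_eq[of w] by (cases "w = 0") auto
  also have "\<i> * of_real (Arg w) = - \<i> * of_real \<kappa> * of_real (- Arg w / \<kappa>)"
    using assms by simp
  finally show "w \<in> range (\<lambda>t. exp (- \<i> * of_real \<kappa> * of_real t))" by blast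
qed (auto simp: norm_exp_eq_Re)

context torus_knot begin

text \<open>A circle-valued \<open>z\<close> is chosen pointwise for an arbitrary natural
  parametrization. \<open>natural_speed\<close> fixes its derivative, so the period and the rotation
  of all lifts are known and the description in \<open>curve_eps\<close> has exactly one
  solution.\<close>

lemma curve_eps_natural:
  assumes "natural_parametrization \<gamma> knot"
  shows "curve_eps \<gamma> = cis (2 * pi * (p + q) / 3)"
proof -
  have "range \<gamma> = knot" "natural \<gamma>"
    using assms by (auto simp: natural_parametrization_def knot_parametrization_def)
  then have "\<exists>z. norm z = 1 \<and> \<gamma> t = pt z" for t
    by (auto simp: knot_def image_iff set_eq_iff[of "range \<gamma>"])
  then obtain z where z: "\<And>t. norm (z t) = 1" "\<And>t. \<gamma> t = pt (z t)" by metis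
  obtain \<Gamma> where \<Gamma>: "wilczynski_lift \<Gamma> \<gamma>" "\<And>t. \<i> * inverse (herm (\<Gamma> t) (vderiv \<Gamma> t)) = 1"
    using \<open>natural \<gamma>\<close> by (auto simp: natural_def)
  note speed = natural_speed[OF \<Gamma> z]
  have "\<gamma> = (\<lambda>t. pt (z t))" using z(2) by auto
  then have period: "minimal_period \<gamma> (2 * pi / \<tau>)"
    using minimal_period_pt[OF z(1) speed] by simp
  note rotates = wilczynski_lift_rotates[OF _ z speed]
  show ?thesis
    unfolding curve_eps_def
  proof (rule the_equality)
    show "\<exists>\<Gamma> \<omega>. wilczynski_lift \<Gamma> \<gamma> \<and> minimal_period \<gamma> \<omega> \<and> \<Gamma> \<omega> = cis (2 * pi * (p + q) / 3) *s \<Gamma> 0"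
      using \<Gamma>(1) period rotates by blast
  next
    fix \<epsilon> assume "\<exists>\<Gamma> \<omega>. wilczynski_lift \<Gamma> \<gamma> \<and> minimal_period \<gamma> \<omega> \<and> \<Gamma> \<omega> = \<epsilon> *s \<Gamma> 0"
    then obtain \<Gamma>' \<omega> where G: "wilczynski_lift \<Gamma>' \<gamma>" "minimal_period \<gamma> \<omega>" "\<Gamma>' \<omega> = \<epsilon> *s \<Gamma>' 0"
      by blast
    have "\<epsilon> *s \<Gamma>' 0 = cis (2 * pi * (p + q) / 3) *s \<Gamma>' 0"
      using minimal_period_unique[OF G(2) period] rotates[OF G(1)] G(3) by metis
    moreover have "\<Gamma>' 0 \<noteq> 0"
      using G(1) by (auto simp: wilczynski_lift_def is_lift_def null_vectors_def)
    ultimately show "\<epsilon> = cis (2 * pi * (p + q) / 3)"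
      by (simp only: vector_mul_rcancel) simp
  qed
qed

text \<open>Existence half of the definite description \<open>knot_eps\<close>. An explicit lift
  with exponential \<open>\<mu>\<close> and \<open>z\<close> satisfies both conditions.\<close>

lemma natural_parametrization_exists: "natural_parametrization (\<lambda>t. pt (exp (- \<i> * of_real \<tau> * of_real t))) knot"
proof -
  define z where "z t = exp (- \<i> * of_real \<tau> * of_real t)" for t
  define \<gamma> where "\<gamma> t = pt (z t)" for t
  have z1: "norm (z t) = 1" for t by (simp add: z_def norm_exp_eq_Re)
  have speed: "(z has_vector_derivative - \<i> * of_real \<tau> * z t) (at t)" for t
    unfolding z_def by (rule exp_linear_log_derivative)
  define c where "c = (- \<i> * of_real \<tau>) ^ 3 * (A * B * C * of_nat (p * q * (q - p)))"
  have norm_c: "norm c = \<tau> ^ 3 * E"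
    using \<tau>_pos p_less_q by (simp only: c_def E_def norm_mult norm_power norm_of_nat norm_minus_cancel) (simp add: of_nat_diff)
  then have c: "c \<noteq> 0" using \<tau>_pos E_pos by auto
  \<comment> \<open>Forced by \<open>lift_det \<Gamma> 0 = -1\<close>. Its modulus then comes out as
    \<open>M / \<delta>\<close>, as the Hermitian condition demands.\<close>
  obtain \<mu>0 where \<mu>0: "\<mu>0 ^ 3 = - (1 / c)" using cube_root_exists .
  have "norm \<mu>0 ^ 3 = norm (\<mu>0 ^ 3)" by (simp add: norm_power)
  also have "\<dots> = 1 / (\<tau> ^ 3 * E)" by (simp add: \<mu>0 norm_divide norm_c)
  also have "\<dots> = (M / \<delta>) ^ 3"
    using M_pos \<delta>_pos by (simp add: \<tau>_def M_cube[symmetric] field_simps)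
  finally have norm_\<mu>0: "norm \<mu>0 = M / \<delta>"
    using M_pos \<delta>_pos by (simp add: power_eq_iff_eq_base)
  \<comment> \<open>The rate for which \<open>3 * l\<close> cancels the logarithmic derivative of
    \<open>z ^ (p + q)\<close>.\<close>
  define l where "l = \<i> * of_real (\<tau> * (p + q) / 3)"
  define \<mu> where "\<mu> t = \<mu>0 * exp (l * of_real t)" for t
  define \<Gamma> where "\<Gamma> t = \<mu> t *s torus_vec (z t)" for t
  have \<mu>: "(\<mu> has_vector_derivative l * \<mu> t) (at t)" for t
    unfolding \<mu>_def using has_vector_derivative_mult_right[OF exp_linear_log_derivative] by (simp add: mult_ac)
  have norm_\<mu>: "norm (\<mu> t) = M / \<delta>" for t
    by (simp add: \<mu>_def l_def norm_mult norm_\<mu>0 norm_exp_eq_Re)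
  then have \<mu>_nz: "\<mu> t \<noteq> 0" for t using M_pos \<delta>_pos by (metis divide_pos_pos norm_zero less_irrefl)
  \<comment> \<open>Both \<open>l\<close> and \<open>\<zeta>\<close> are constant functions
    here.\<close>
  note frame = \<mu> has_vector_derivative_const speed has_vector_derivative_const z1
  have herm: "herm (\<Gamma> t) (vderiv \<Gamma> t) = \<i>" for t
  proof -
    have "(M / \<delta>)\<^sup>2 * \<delta> * \<tau> = 1"
      using M_pos \<delta>_pos by (simp add: \<tau>_def field_simps power2_eq_square)
    then have "of_real ((M / \<delta>)\<^sup>2 * \<delta>) * of_real \<tau> = (1 :: complex)"
      by (simp only: of_real_mult[symmetric] of_real_1)
    then show ?thesis
      using herm_frame[OF frame, of t] unfolding norm_\<mu> \<Gamma>_def[abs_def] by (simp add: mult.assoc)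
  qed
  have det: "lift_det \<Gamma> t = -1" for t
  proof -
    have "\<mu> t ^ 3 * z t ^ (p + q) = \<mu>0 ^ 3 * exp (of_nat 3 * (l * of_real t) + of_nat (p + q) * (- \<i> * of_real \<tau> * of_real t))"
      by (simp only: \<mu>_def z_def power_mult_distrib exp_add exp_of_nat_mult mult.assoc)
    also have "of_nat 3 * (l * of_real t) + of_nat (p + q) * (- \<i> * of_real \<tau> * of_real t) = 0"
      by (simp add: l_def field_simps)
    finally have "\<mu> t ^ 3 * z t ^ (p + q) = - (1 / c)" by (simp add: \<mu>0)
    then have "\<mu> t ^ 3 * z t ^ (p + q) * c = -1" using c by simp
    then show ?thesis
      using lift_det_frame[OF frame, of t] unfolding \<Gamma>_def[abs_def] c_def by (simp add: mult.assoc)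
  qed
  have "exp ((l + of_nat a * (- \<i> * of_real \<tau>)) * of_real t) = exp (l * of_real t) * z t ^ a" for a t
    by (simp only: z_def distrib_right exp_add mult.assoc exp_of_nat_mult)
  then have \<Gamma>_eq: "(\<lambda>t. Umat *v vector [(A * \<mu>0) * exp ((l + of_nat p * (- \<i> * of_real \<tau>)) * of_real t),
      (B * \<mu>0) * exp ((l + of_nat q * (- \<i> * of_real \<tau>)) * of_real t), (C * \<mu>0) * exp (l * of_real t)]) = \<Gamma>"
    by (intro ext) (simp only: \<Gamma>_def scale_torus_vec \<mu>_def mult.assoc)
  have smooth: "smooth_on UNIV \<Gamma>"
    unfolding \<Gamma>_eq[symmetric] by (rule smooth_on_Umat_exp)
  have in_null: "\<Gamma> t \<in> null_vectors" for t
    unfolding \<Gamma>_def using z1 \<mu>_nz by (rule scale_torus_vec_null)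
  have \<gamma>_eq: "\<gamma> t = cproj (\<Gamma> t)" for t
  proof -
    have "\<Gamma> t \<noteq> 0" using in_null by (auto simp: null_vectors_def)
    then show ?thesis
      unfolding \<gamma>_def pt_def using cproj_eq_iff[of "\<Gamma> t" "torus_vec (z t)"] torus_vec_nonzero \<mu>_nz \<Gamma>_def by blast
  qed
  have lift: "is_lift \<Gamma> \<gamma>"
    using smooth in_null \<gamma>_eq by (simp add: is_lift_def)
  have "smooth_curve \<gamma>"
    unfolding smooth_curve_def
  proof (intro conjI allI)
    show "\<gamma> t \<in> hyperquadric" for t
      using in_null[of t] \<gamma>_eq[of t] by (auto simp: hyperquadric_def null_vectors_def)
    show "\<exists>I Z. open I \<and> t \<in> I \<and> smooth_on I Z \<and> (\<forall>u\<in>I. Z u \<noteq> 0 \<and> \<gamma> u = cproj (Z u))" for t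
      using smooth in_null \<gamma>_eq by (intro exI[of _ UNIV] exI[of _ \<Gamma>]) (auto simp: null_vectors_def)
  qed
  moreover have "transversal \<gamma>"
    unfolding transversal_def using lift herm by (intro exI[of _ \<Gamma>]) simp
  moreover have "generic \<gamma>"
    unfolding generic_def using lift det by (intro exI[of _ \<Gamma>]) simp
  moreover have "natural \<gamma>"
    unfolding natural_def wilczynski_lift_def using lift det herm by (intro exI[of _ \<Gamma>]) simp
  moreover have "minimal_period \<gamma> (2 * pi / \<tau>)" "inj_on \<gamma> {0..<2 * pi / \<tau>}"
    using minimal_period_pt[OF z1 speed] inj_on_pt[OF z1 speed] by (simp_all add: \<gamma>_def[abs_def])
  moreover have "range \<gamma> = knot"
  proof -
    have "range z = {w. norm w = 1}"
      using \<tau>_pos range_exp_circle[of \<tau>] by (simp add: z_def[abs_def])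
    then show ?thesis
      unfolding knot_def \<gamma>_def by (metis image_image)
  qed
  ultimately show ?thesis
    unfolding natural_parametrization_def knot_parametrization_def \<gamma>_def[abs_def] z_def by blast
qed

theorem knot_eps_knot: "knot_eps knot = cis (2 * pi * (p + q) / 3)"
  unfolding knot_eps_def
proof (rule the_equality)
  show "\<exists>\<gamma>. natural_parametrization \<gamma> knot \<and> cis (2 * pi * (p + q) / 3) = curve_eps \<gamma>"
    using natural_parametrization_exists curve_eps_natural by force
qed (use curve_eps_natural in blast)

end

section \<open>Symmetrical configurations as torus knots\<close>

lemma sums_vec:
  fixes f :: "nat \<Rightarrow> 'a::real_normed_vector^'n"
  assumes "\<And>i. (\<lambda>k. f k $ i) sums (s $ i)"
  shows "f sums s"
  using assms unfolding sums_def by (intro vec_tendstoI) (simp add: sum_component)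

definition diag3 :: "complex \<Rightarrow> complex \<Rightarrow> complex \<Rightarrow> complex^3^3" where
  "diag3 a b c = vector [vector [a, 0, 0], vector [0, b, 0], vector [0, 0, c]]"

lemma diag3_power: "(((**) (diag3 a b c)) ^^ k) (mat 1) = diag3 (a ^ k) (b ^ k) (c ^ k)"
proof (induction k)
  case 0
  show ?case by (simp add: diag3_def mat_def vec_eq_iff forall_3)
next
  case (Suc k)
  then show ?case
    by (simp add: diag3_def matrix_matrix_mult_def vec_eq_iff forall_3 sum_3)
qed

lemma mat_exp_diag3: "mat_exp (diag3 a b c) = diag3 (exp a) (exp b) (exp c)"
proof -
  have "(\<lambda>k. (1 / fact k) *\<^sub>R x ^ k) sums exp x" for x :: complex
    using exp_converges[of x] by (simp add: inverse_eq_divide)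
  then have "\<forall>i j. (\<lambda>k. ((1 / fact k) *\<^sub>R diag3 (a ^ k) (b ^ k) (c ^ k)) $ i $ j)
      sums (diag3 (exp a) (exp b) (exp c) $ i $ j)"
    unfolding forall_3 by (simp add: diag3_def)
  then have "(\<lambda>k. (1 / fact k) *\<^sub>R diag3 (a ^ k) (b ^ k) (c ^ k)) sums diag3 (exp a) (exp b) (exp c)"
    by (intro sums_vec) blast
  then show ?thesis
    unfolding mat_exp_def diag3_power by (rule sums_unique[symmetric])
qed

text \<open>\<open>config_A \<rho>\<close>, \<open>\<rho>\<close> and \<open>config_C \<rho>\<close>
  are the coordinates of the starting vector after applying \<open>Uinv\<close>.\<close>

definition config_A :: "real \<Rightarrow> complex" where
  "config_A \<rho> = of_real ((1 + \<rho>\<^sup>2 / 2) / sqrt 2)"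

definition config_C :: "real \<Rightarrow> complex" where
  "config_C \<rho> = - \<i> * of_real ((1 - \<rho>\<^sup>2 / 2) / sqrt 2)"

lemma sym_config_eq:
  "sym_config r \<rho> s = cproj (Umat *v vector
     [config_A \<rho> * exp (- \<i> * of_real (e12 r \<rho> * s)), of_real \<rho> * exp (- \<i> * of_real (e13 r \<rho> * s)),
      config_C \<rho> * exp (- \<i> * of_real (e11 r \<rho> * s))])"
proof -
  have "s *\<^sub>R D1 r \<rho> = diag3 (- \<i> * of_real (e12 r \<rho> * s)) (- \<i> * of_real (e13 r \<rho> * s)) (- \<i> * of_real (e11 r \<rho> * s))"
    by (simp add: D1_def diag3_def vec_eq_iff forall_3) (simp add: scaleR_conv_of_real)
  moreover have "Uinv *v vector [1, of_real \<rho>, \<i> * of_real (\<rho>\<^sup>2 / 2)] = vector [config_A \<rho>, of_real \<rho>, config_C \<rho>]"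
    by (simp add: Uinv_def config_A_def config_C_def vec_eq_iff forall_3 matrix_vector_mult_def sum_3)
       (simp add: field_simps)
  moreover have "diag3 a b c *v vector [x, y, z] = vector [x * a, y * b, z * c]" for a b c x y z
    by (simp add: diag3_def vec_eq_iff forall_3 matrix_vector_mult_def sum_3)
  ultimately show ?thesis
    by (simp only: sym_config_def Spt_def proj_act_cproj matrix_inv_Umat mat_exp_diag3
        matrix_vector_mul_assoc[symmetric])
qed

text \<open>Dividing by the third exponential leaves the powers \<open>p\<close> and
  \<open>q\<close> of \<open>exp (- \<i> * \<kappa> * s)\<close>, which sweeps out the whole circle.
  Only the point sets are compared.\<close>

lemma trajectory_sym_config:
  fixes \<kappa> :: real
  assumes "torus_knot (config_A \<rho>) (of_real \<rho>) (config_C \<rho>) p q"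
    and "e12 r \<rho> - e11 r \<rho> = p * \<kappa>" "e13 r \<rho> - e11 r \<rho> = q * \<kappa>" "\<kappa> \<noteq> 0"
  shows "trajectory (sym_config r \<rho>) = torus_knot.knot (config_A \<rho>) (of_real \<rho>) (config_C \<rho>) p q"
proof -
  interpret torus_knot "config_A \<rho>" "of_real \<rho>" "config_C \<rho>" p q by fact
  have "sym_config r \<rho> s = pt (exp (- \<i> * of_real \<kappa> * of_real s))" for s
  proof -
    define z where "z = exp (- \<i> * of_real \<kappa> * of_real s)"
    define c where "c = exp (- \<i> * of_real (e11 r \<rho> * s))"
    have e: "e12 r \<rho> = e11 r \<rho> + p * \<kappa>" "e13 r \<rho> = e11 r \<rho> + q * \<kappa>"
      using assms(2,3) by simp_all
    have "exp (- \<i> * of_real ((e11 r \<rho> + real a * \<kappa>) * s)) = c * z ^ a" for a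
    proof -
      have "- \<i> * of_real ((e11 r \<rho> + real a * \<kappa>) * s)
        = - \<i> * of_real (e11 r \<rho> * s) + of_nat a * (- \<i> * of_real \<kappa> * of_real s)"
        by (simp add: algebra_simps)
      then show ?thesis by (simp only: c_def z_def exp_add exp_of_nat_mult)
    qed
    then have "sym_config r \<rho> s = cproj (c *s torus_vec z)"
      unfolding sym_config_eq e scale_torus_vec c_def[symmetric] by simp
    also have "\<dots> = cproj (torus_vec z)"
      using torus_vec_nonzero[of z] by (subst cproj_eq_iff) (auto simp: c_def)
    finally show ?thesis by (simp add: pt_def z_def)
  qed
  then have "trajectory (sym_config r \<rho>) = pt ` range (\<lambda>s. exp (- \<i> * of_real \<kappa> * of_real s))"
    by (auto simp: trajectory_def)
  then show ?thesis
    using range_exp_circle[OF \<open>\<kappa> \<noteq> 0\<close>] by (simp add: knot_def)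
qed

text \<open>Completing the square: with \<open>t = 1 + 2 * r < 0\<close>, the expression times
  \<open>t\<close> is \<open>(t * \<rho>\<^sup>2 + 6)\<^sup>2 - (4 * S)\<^sup>2\<close>, and the
  bound on \<open>\<rho>\<close> in \<open>config_domain\<close> says
  \<open>t * \<rho>\<^sup>2 + 6 > 4 * S\<close>.\<close>

lemma config_domain_numerator_neg:
  assumes "(r, \<rho>) \<in> config_domain"
  shows "4 + 8 * r + 12 * \<rho>\<^sup>2 + (1 + 2 * r) * \<rho> ^ 4 < 0"
proof -
  define S where "S = sqrt (2 - r - r\<^sup>2)"
  define t where "t = 1 + 2 * r"
  have r: "- 2 < r" "t < 0" and \<rho>: "0 < \<rho>" "\<rho> < sqrt (2 * (- 3 + 2 * S) / t)"
    using assms by (auto simp: config_domain_def S_def t_def)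
  have "2 - r - r\<^sup>2 = (1 - r) * (2 + r)" by (simp add: algebra_simps power2_eq_square)
  then have S: "S\<^sup>2 = 2 - r - r\<^sup>2" "S \<ge> 0"
    using r by (auto simp: S_def t_def)
  \<comment> \<open>The real \<open>sqrt\<close> is odd, so a positive root means a positive
    radicand, and squaring is legitimate.\<close>
  have "sqrt (2 * (- 3 + 2 * S) / t) > 0" using \<rho> by linarith
  then have "\<rho>\<^sup>2 < 2 * (- 3 + 2 * S) / t"
    using \<rho> by (metis less_eq_real_def real_sqrt_gt_0_iff real_sqrt_pow2 power_strict_mono pos2)
  then have "t * \<rho>\<^sup>2 + 6 > 4 * S"
    using r by (simp add: field_simps)
  then have "(4 * S)\<^sup>2 < (t * \<rho>\<^sup>2 + 6)\<^sup>2"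
    using S by (intro power_strict_mono) auto
  moreover have "(t * \<rho>\<^sup>2 + 6)\<^sup>2 - (4 * S)\<^sup>2 = t * (4 + 8 * r + 12 * \<rho>\<^sup>2 + (1 + 2 * r) * \<rho> ^ 4)"
    unfolding t_def power_mult_distrib S(1) by (simp add: algebra_simps power2_eq_square power4_eq_xxxx)
  ultimately have "t * (4 + 8 * r + 12 * \<rho>\<^sup>2 + (1 + 2 * r) * \<rho> ^ 4) > 0" by linarith
  then show ?thesis using r by (simp add: zero_less_mult_iff)
qed

text \<open>With \<open>N\<close> the numerator and \<open>P\<close> the power in
  \<open>mu1\<close>, \<open>mu1 = N / (N - 2 * P)\<close>, so
  \<open>mu1 / (1 - mu1) = - N / (2 * P)\<close>.\<close>

lemma e13_pos:
  assumes "(r, \<rho>) \<in> config_domain"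
  shows "e13 r \<rho> > 0"
proof -
  define N where "N = 4 + 8 * r + 12 * \<rho>\<^sup>2 + (1 + 2 * r) * \<rho> ^ 4"
  define P where "P = ((2 + 3 * r - 3 * r^2 - 2 * r^3) * (- 4 * \<rho> + \<rho>^5)) powr (2 / 3)"
  have N: "N < 0" using config_domain_numerator_neg[OF assms] by (simp add: N_def)
  have r: "- 2 < r" "r < - 1 / 2" "0 < \<rho>" "\<rho> < sqrt 2"
    using assms by (auto simp: config_domain_def)
  then have "\<rho>\<^sup>2 < (sqrt 2)\<^sup>2" by (intro power_strict_mono) auto
  then have "\<rho>\<^sup>2 < 2" by simp
  moreover have "- 4 * \<rho> + \<rho>^5 = \<rho> * (\<rho>\<^sup>2 - 2) * (\<rho>\<^sup>2 + 2)"
    "2 + 3 * r - 3 * r^2 - 2 * r^3 = (1 - r) * (2 + r) * (1 + 2 * r)"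
    by algebra+
  \<comment> \<open>Nonzero factors suffice for \<open>P > 0\<close>, since \<open>x powr a\<close>
    is positive at every nonzero \<open>x\<close>.\<close>
  moreover have "\<rho>\<^sup>2 + 2 \<noteq> 0" by (smt (verit) zero_le_power2)
  ultimately have "P > 0"
    using r by (simp add: P_def)
  then have "e13 r \<rho> = - N / (2 * P)"
    using N unfolding e13_def mu1_def N_def[symmetric] P_def[symmetric] by (simp add: field_simps)
  then show ?thesis using N \<open>P > 0\<close> by (simp add: divide_neg_pos)
qed

text \<open>After multiplication by \<open>k\<close>, the inequality \<open>positive\<close> says
  that the numerator of \<open>mu1\<close>, divided by 8, is negative. So the domain condition is
  what gives transversality.\<close>

lemma torus_knot_config:
  assumes dom: "(r, \<rho>) \<in> config_domain"
    and pq: "0 < p" "p < q" "coprime p q"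
    and ratio: "- (1 + 2 * r) = real p * k" "1 - r = real q * k" "k > 0"
  shows "torus_knot (config_A \<rho>) (of_real \<rho>) (config_C \<rho>) p q"
proof
  have \<rho>: "0 < \<rho>" "\<rho> < sqrt 2" using dom by (auto simp: config_domain_def)
  then have "\<rho>\<^sup>2 < (sqrt 2)\<^sup>2" by (intro power_strict_mono) auto
  then have \<rho>2: "\<rho>\<^sup>2 < 2" by simp
  have pos: "1 + \<rho>\<^sup>2 / 2 > 0" by (smt (verit) zero_le_power2 divide_nonneg_pos)
  show "config_A \<rho> \<noteq> 0" unfolding config_A_def of_real_eq_0_iff using pos by simp
  show "complex_of_real \<rho> \<noteq> 0" using \<rho> by simp
  have "(1 - \<rho>\<^sup>2 / 2) / sqrt 2 \<noteq> 0" using \<rho>2 by simp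
  then show "config_C \<rho> \<noteq> 0"
    unfolding config_C_def mult_eq_0_iff of_real_eq_0_iff by simp
  have nA: "(norm (config_A \<rho>))\<^sup>2 = (1 + \<rho>\<^sup>2 / 2)\<^sup>2 / 2"
    by (simp only: config_A_def norm_of_real power2_abs power_divide) simp
  have nC: "(norm (config_C \<rho>))\<^sup>2 = (1 - \<rho>\<^sup>2 / 2)\<^sup>2 / 2"
    by (simp only: config_C_def norm_mult norm_minus_cancel norm_ii norm_of_real mult_1_left power2_abs power_divide) simp
  show "(norm (complex_of_real \<rho>))\<^sup>2 + (norm (config_C \<rho>))\<^sup>2 = (norm (config_A \<rho>))\<^sup>2"
    unfolding nA nC by (simp add: field_simps power2_eq_square)
  have "(1 - r) * \<rho>\<^sup>2 - (- (1 + 2 * r)) * ((1 + \<rho>\<^sup>2 / 2)\<^sup>2 / 2)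
     = (4 + 8 * r + 12 * \<rho>\<^sup>2 + (1 + 2 * r) * \<rho> ^ 4) / 8"
    by (simp add: field_simps power2_eq_square power4_eq_xxxx)
  also have "\<dots> < 0" using config_domain_numerator_neg[OF dom] by simp
  finally have "k * (q * \<rho>\<^sup>2) < k * (p * ((1 + \<rho>\<^sup>2 / 2)\<^sup>2 / 2))"
    unfolding ratio by (simp add: algebra_simps)
  then show "real q * (norm (complex_of_real \<rho>))\<^sup>2 < real p * (norm (config_A \<rho>))\<^sup>2"
    using \<open>k > 0\<close> unfolding nA by simp
qed (use pq in auto)

text \<open>All three spectral values are multiples of \<open>e13\<close>, so \<open>\<rho>\<close>
  affects the speed but not \<open>p\<close> and \<open>q\<close>. The invariant depends on
  \<open>r\<close> alone.\<close>

lemma knot_eps_sym_config: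
  assumes dom: "(r, \<rho>) \<in> config_domain"
    and pq: "0 < p" "p < q" "coprime p q"
    and ratio: "- (1 + 2 * r) = real p * k" "1 - r = real q * k" "k > 0"
  shows "knot_eps (trajectory (sym_config r \<rho>)) = cis (2 * pi * (p + q) / 3)"
proof -
  note T = torus_knot_config[OF assms]
  have e: "e11 r \<rho> = r * e13 r \<rho>" "e12 r \<rho> = - (1 + r) * e13 r \<rho>"
    by (simp_all only: e11_def e12_def e13_def)
  have "e12 r \<rho> - e11 r \<rho> = - (1 + 2 * r) * e13 r \<rho>" "e13 r \<rho> - e11 r \<rho> = (1 - r) * e13 r \<rho>"
    unfolding e by (simp_all add: algebra_simps)
  then have "e12 r \<rho> - e11 r \<rho> = p * (k * e13 r \<rho>)" "e13 r \<rho> - e11 r \<rho> = q * (k * e13 r \<rho>)"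
    unfolding ratio by simp_all
  then have "trajectory (sym_config r \<rho>) = torus_knot.knot (config_A \<rho>) (of_real \<rho>) (config_C \<rho>) p q"
    using T e13_pos[OF dom] \<open>k > 0\<close> by (intro trajectory_sym_config) auto
  then show ?thesis using torus_knot.knot_eps_knot[OF T] by simp
qed

text \<open>Reducing \<open>k\<close> modulo 3 changes the angle by a multiple of a full turn and
  brings it into the range of \<open>Arg2pi\<close>.\<close>

lemma Arg2pi_cis_third:
  "Arg2pi (cis (2 * pi * of_int k / 3)) = 2 * pi * of_int (k mod 3) / 3"
proof -
  have "2 * pi * of_int k / 3 = 2 * pi * of_int (k mod 3) / 3 + 2 * pi * of_int (k div 3)"
  proof -
    have "real_of_int k = of_int (k mod 3) + 3 * of_int (k div 3)"
      by (metis mod_mult_div_eq add.commute of_int_add of_int_mult of_int_numeral)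
    then show ?thesis by (simp add: field_simps)
  qed
  then have "cis (2 * pi * of_int k / 3) = cis (2 * pi * of_int (k mod 3) / 3) * cis (2 * pi * of_int (k div 3))"
    by (simp only: cis_mult)
  also have "cis (2 * pi * of_int (k div 3)) = 1"
    by (rule cis_multiple_2pi) simp
  finally have "cis (2 * pi * of_int k / 3) = cis (2 * pi * of_int (k mod 3) / 3)" by simp
  moreover have "2 * pi * real_of_int (k mod 3) / 3 < 2 * pi"
  proof -
    have "real_of_int (k mod 3) < 3" by (simp add: pos_mod_bound[of 3 k, simplified])
    then show ?thesis by simp
  qed
  ultimately show ?thesis
    by (intro Arg2pi_unique[of 1]) (auto simp: cis_conv_exp)
qed

theorem proposition4p7:
  fixes m n :: int and r \<rho> :: real and K :: "cpoint set"
  assumes "gcd m n = 1" and "m < 0"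
    and "r = of_int m / of_int n"
    and "(r, \<rho>) \<in> config_domain"
    and "K = trajectory (sym_config r \<rho>)"
  shows "(cr_spin K = 1 / 3 \<and> phase_anomaly K = 4 * pi / 3 \<longleftrightarrow>
            (\<exists>h k :: int. h < 0 \<and> k > 0 \<and> m = 1 + 3 * h \<and> n = 1 + 3 * k)) \<and>
         (cr_spin K = 1 / 3 \<and> phase_anomaly K = 2 * pi / 3 \<longleftrightarrow>
            (\<exists>h k :: int. h < 0 \<and> k > 0 \<and> m = 2 + 3 * h \<and> n = 2 + 3 * k))"
proof -
  have r: "- 2 < r" "r < - 1 / 2" using assms(4) by (auto simp: config_domain_def)
  have n: "n > 0"
  proof (rule ccontr)
    assume "\<not> n > 0"
    then have "r \<ge> 0" using assms(2,3) by (simp add: divide_nonpos_nonpos)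
    then show False using r by simp
  qed
  have "real_of_int (2 * m) < real_of_int (- n)" "real_of_int (- 2 * n) < real_of_int m"
    using r n by (simp_all add: assms(3) field_simps)
  then have m: "2 * m < - n" "- 2 * n < m" by linarith+
  \<comment> \<open>\<open>P / n\<close> and \<open>Q / n\<close> equal \<open>- (1 + 2 * r)\<close>
    and \<open>1 - r\<close>, the frequency differences in units of \<open>e13\<close>. Division by
    \<open>g\<close> gives the coprime exponents.\<close>
  define P Q g where "P = - (n + 2 * m)" and "Q = n - m" and "g = gcd P Q"
  have PQ: "P > 0" "Q > P" using m by (auto simp: P_def Q_def)
  have g_pos: "g > 0" using PQ by (simp add: g_def)
  have "g dvd P" "g dvd Q" by (simp_all add: g_def)
  then obtain p' q' where p'q': "P = g * p'" "Q = g * q'" by (auto elim!: dvdE)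
  define p q where "p = nat p'" and "q = nat q'"
  have pq': "p' > 0" "q' > p'"
    using PQ g_pos unfolding p'q' by (simp_all add: zero_less_mult_iff)
  then have pq: "int p = p'" "int q = q'" "0 < p" "p < q" by (auto simp: p_def q_def)
  have "coprime p' q'"
  proof -
    have "P div g = p'" "Q div g = q'" using g_pos by (simp_all add: p'q')
    then show ?thesis using div_gcd_coprime[of P Q] PQ(1) by (simp add: g_def)
  qed
  then have cop: "coprime p q" using pq(1,2) by (metis coprime_int_iff)
  have "g dvd gcd (3 * m) (3 * n)"
  proof (rule gcd_greatest)
    have "3 * m = - (P + Q)" "3 * n = 2 * Q - P" by (simp_all add: P_def Q_def)
    then show "g dvd 3 * m" "g dvd 3 * n" using \<open>g dvd P\<close> \<open>g dvd Q\<close> by auto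
  qed
  then have "g dvd 3" using assms(1) by (simp add: gcd_mult_distrib_int[symmetric])
  then have g: "g = 1 \<or> g = 3"
  proof -
    have "g = 1 \<or> g = 2 \<or> g = 3"
      using g_pos zdvd_imp_le[OF \<open>g dvd 3\<close>] by linarith
    then show ?thesis using \<open>g dvd 3\<close> by auto
  qed
  \<comment> \<open>Since \<open>P = 2 * Q - 3 * n\<close>, 3 divides both as soon as it divides
    \<open>Q = n - m\<close>.\<close>
  have g3: "g = 3 \<longleftrightarrow> 3 dvd n - m"
  proof
    assume "3 dvd n - m"
    then have "3 dvd P" "3 dvd Q" by (auto simp: P_def Q_def) presburger
    then have "3 dvd g" by (simp add: g_def)
    then show "g = 3" using g by auto
  qed (use \<open>g dvd Q\<close> in \<open>auto simp: Q_def\<close>)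
  have ratio: "- (1 + 2 * r) = real p * (of_int g / of_int n)" "1 - r = real q * (of_int g / of_int n)"
  proof -
    have "real p * of_int g = of_int P" "real q * of_int g = of_int Q"
      unfolding p'q' by (simp_all flip: pq(1,2))
    then show "- (1 + 2 * r) = real p * (of_int g / of_int n)" "1 - r = real q * (of_int g / of_int n)"
      unfolding times_divide_eq_right using n by (simp_all add: assms(3) P_def Q_def add_divide_distrib diff_divide_distrib)
  qed
  define j where "j = int (p + q)"
  have "g * j = - 3 * m"
  proof -
    have "g * j = P + Q" by (simp only: j_def of_nat_add pq p'q' distrib_left)
    then show ?thesis by (simp add: P_def Q_def)
  qed
  have eps: "knot_eps K = cis (2 * pi * of_int j / 3)"
    using knot_eps_sym_config[OF assms(4) pq(3,4) cop ratio] g_pos n by (simp add: assms(5) j_def)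
  then have anomaly: "phase_anomaly K = 2 * pi * of_int (j mod 3) / 3"
    by (simp add: phase_anomaly_def Arg2pi_cis_third)
  \<comment> \<open>Spin 1 would mean \<open>knot_eps K = 1\<close>, hence anomaly 0; the case
    \<open>k = 0\<close> evaluates \<open>Arg2pi 1\<close>.\<close>
  have spin: "cr_spin K = 1 / 3" if "phase_anomaly K \<noteq> 0"
    using that Arg2pi_cis_third[of 0] by (auto simp: cr_spin_def phase_anomaly_def)
  have "phase_anomaly K = 4 * pi / 3 \<longleftrightarrow> j mod 3 = 2" "phase_anomaly K = 2 * pi / 3 \<longleftrightarrow> j mod 3 = 1"
  proof -
    have "2 * pi * of_int i / 3 = 4 * pi / 3 \<longleftrightarrow> i = 2" "2 * pi * of_int i / 3 = 2 * pi / 3 \<longleftrightarrow> i = 1" for i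
      by auto
    then show "phase_anomaly K = 4 * pi / 3 \<longleftrightarrow> j mod 3 = 2" "phase_anomaly K = 2 * pi / 3 \<longleftrightarrow> j mod 3 = 1"
      unfolding anomaly by blast+
  qed
  then have iff: "cr_spin K = 1 / 3 \<and> phase_anomaly K = 4 * pi / 3 \<longleftrightarrow> j mod 3 = 2"
    "cr_spin K = 1 / 3 \<and> phase_anomaly K = 2 * pi / 3 \<longleftrightarrow> j mod 3 = 1"
    using spin by (metis divide_eq_0_iff mult_eq_0_iff pi_neq_zero zero_neq_numeral)+
  have j_mod: "j mod 3 = 2 \<longleftrightarrow> m mod 3 = 1 \<and> n mod 3 = 1" "j mod 3 = 1 \<longleftrightarrow> m mod 3 = 2 \<and> n mod 3 = 2"
  proof -
    \<comment> \<open>The cases \<open>g = 1\<close>, where \<open>j = - 3 * m\<close>, and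
      \<open>g = 3\<close>, where \<open>j = - m\<close>.\<close>
    have "j mod 3 = 0 \<and> \<not> 3 dvd n - m \<or> j = - m \<and> 3 dvd n - m"
      using g g3 \<open>g * j = - 3 * m\<close> by auto
    then show "j mod 3 = 2 \<longleftrightarrow> m mod 3 = 1 \<and> n mod 3 = 1" "j mod 3 = 1 \<longleftrightarrow> m mod 3 = 2 \<and> n mod 3 = 2"
      by (elim disjE; presburger)+
  qed
  have mod_3: "m mod 3 = i \<and> n mod 3 = i \<longleftrightarrow> (\<exists>h k. h < 0 \<and> k > 0 \<and> m = i + 3 * h \<and> n = i + 3 * k)"
    if "i = 1 \<or> i = 2" for i
  proof
    assume i: "m mod 3 = i \<and> n mod 3 = i"
    define h k where "h = m div 3" and "k = n div 3"
    have e: "m = i + 3 * h" "n = i + 3 * k"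
      unfolding h_def k_def using i mod_mult_div_eq[of m 3] mod_mult_div_eq[of n 3] by simp_all
    have "i \<ge> 1" "i \<le> 2" using that by auto
    then have "h < 0" "k \<ge> 0" using m n e by linarith+
    \<comment> \<open>If \<open>n = i\<close>, the bounds leave \<open>m = -1\<close> for
      \<open>i = 1\<close> and \<open>m = -3\<close> or \<open>m = -2\<close> for
      \<open>i = 2\<close>. None of these is congruent to \<open>i\<close> modulo 3.\<close>
    moreover have "k \<noteq> 0"
    proof
      assume "k = 0"
      then have "2 * m < - i" "- 2 * i < m" using m e by simp_all
      then show False using that e(1) by presburger
    qed
    ultimately have "h < 0" "k > 0" by simp_all
    with e show "\<exists>h k. h < 0 \<and> k > 0 \<and> m = i + 3 * h \<and> n = i + 3 * k" by (intro exI conjI)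
  next
    assume "\<exists>h k. h < 0 \<and> k > 0 \<and> m = i + 3 * h \<and> n = i + 3 * k"
    then obtain h k where "m = i + 3 * h" "n = i + 3 * k" by blast
    moreover have "i mod 3 = i" using that by auto
    ultimately show "m mod 3 = i \<and> n mod 3 = i" by simp
  qed
  show ?thesis
    unfolding iff j_mod using mod_3[of 1] mod_3[of 2] by blast
qed

end
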